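(* For all integers $N\ge 2$ and $L\ge 1$, $$\frac{1}{1+\hbar^{-NL}\,e_{N}^{\circ_{\hbar}L}X^{NL}}=\exp_{\ast_{\hbar}}\left(-\sum_{k\ge 2}\frac{\hbar^{-k}}{k!}\,\phi_{k}\sum_{m=1}^{NL}\bigl(\varphi(1/N;\epsilon_{NL}^{m}X)\bigr)^{k}\right)$$ as formal power series in $X$, where $$\varphi(\theta;x)=\sum_{k\ge1}\frac{x^{k}}{k!}\prod_{a=1}^{k-1}(k\theta-a).$$
   Context: Notation. $\epsilon_{M}=\exp(2\pi i/M)$ for $M\ge1$. $\mathcal{C}=\mathbb{Q}[\hbar,\hbar^{-1}]$. $\widehat{\mathfrak{H}^{1}}=\mathcal{C}\langle e_{1},g_{1},g_{2},g_{3},\ldots\rangle$ is the non-commutative polynomial ring over $\mathcal{C}$ (concatenation product), and $e_{k}=g_{k}+\hbar g_{k-1}$ for $k\ge2$. $\mathcal{A}=\{e_{1}-g_{1}\}\sqcup\{g_{k}\mid k\ge1\}$ freely generates it, and $\mathfrak{z}$ is the free $\mathcal{C}$-module spanned by $\mathcal{A}$. The symmetric (associative) $\mathcal{C}$-bilinear map $\circ_{\hbar}:\mathfrak{z}\times\mathfrak{z}\to\mathfrak{z}$ is given by $(e_{1}-g_{1})\circ_{\hbar}(e_{1}-g_{1})=\hbar(e_{1}-g_{1})$, $(e_{1}-g_{1})\circ_{\hbar}g_{k}=\hbar g_{k}$, $g_{k}\circ_{\hbar}g_{l}=g_{k+l}$ $(k,l\ge1)$. Write $u^{\circ_{\hbar}1}=u$,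 $u^{\circ_{\hbar}n}=u^{\circ_{\hbar}(n-1)}\circ_{\hbar}u$. The harmonic product $\ast_{\hbar}$ on $\widehat{\mathfrak{H}^{1}}$ is the (commutative, associative) $\mathcal{C}$-bilinear product determined by $w\ast_{\hbar}1=1\ast_{\hbar}w=w$ and $(wu)\ast_{\hbar}(w'v)=(w\ast_{\hbar}w'v)u+(wu\ast_{\hbar}w')v+(w\ast_{\hbar}w')(u\circ_{\hbar}v)$ for $w,w'\in\widehat{\mathfrak{H}^{1}}$, $u,v\in\mathcal{A}$. All these operations are extended to power series in the central variable $X$ coefficientwise, and, where needed, from $\mathcal{C}$ to $\mathbb{C}[\hbar,\hbar^{-1}]$. For $f(X)$ in $X\widehat{\mathfrak{H}^{1}}[[X]]$, $\exp_{\ast_{\hbar}}(f)=1+\sum_{n\ge1}\frac{1}{n!}f^{\ast_{\hbar}n}$; $\frac{1}{1+f(X)}=\sum_{n\ge0}(-f(X))^{n}$ is the inverse with respect to concatenation. For $k\ge1$, $\phi_{k}=\sum_{j=1}^{k}(j-1)!\,{k\brace j}\,\hbar^{k-j}g_{j}$, where ${k\brace j}$ is the Stirling number of the second kind. *)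

theory Defs
  imports
    Complex_Main
    "HOL-Library.Poly_Mapping"
    "HOL-Computational_Algebra.Formal_Power_Series"
    "HOL-Combinatorics.Stirling"
    "HOL-Analysis.Infinite_Sum"
begin

section \<open>Laurent polynomials in \<open>\<hbar>\<close> and free modules over them\<close>

text \<open>
  The group ring of the integers over a field \<open>'k\<close> is \<open>'k[\<hbar>, \<hbar>\<^sup>-\<^sup>1]\<close>.  The base ring \<open>\<C>\<close> is the
  case \<open>'k = rat\<close>; its extension, needed once roots of unity occur, is the case \<open>'k = complex\<close>.
\<close>

type_synonym 'k laurent = "int \<Rightarrow>\<^sub>0 'k"

definition hbar_pow :: "int \<Rightarrow> 'k::field_char_0 laurent" where
  "hbar_pow i = Poly_Mapping.single i 1"

abbreviation hbar :: "'k::field_char_0 laurent" where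
  "hbar \<equiv> hbar_pow 1"

definition const :: "'k::field_char_0 \<Rightarrow> 'k laurent" where
  "const c = Poly_Mapping.single 0 c"

definition smul :: "'c::semiring_0 \<Rightarrow> ('a \<Rightarrow>\<^sub>0 'c) \<Rightarrow> ('a \<Rightarrow>\<^sub>0 'c)" (infixr "\<odot>" 75) where
  "c \<odot> x = Poly_Mapping.map ((*) c) x"

text \<open>The bilinear extension of a map given on pairs of basis elements.\<close>

definition bilinear_ext ::
  "('a \<Rightarrow> 'a \<Rightarrow> ('b \<Rightarrow>\<^sub>0 'c::comm_semiring_1)) \<Rightarrow> ('a \<Rightarrow>\<^sub>0 'c) \<Rightarrow> ('a \<Rightarrow>\<^sub>0 'c) \<Rightarrow> ('b \<Rightarrow>\<^sub>0 'c)" where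
  "bilinear_ext f x y =
     (\<Sum>a\<in>Poly_Mapping.keys x. \<Sum>b\<in>Poly_Mapping.keys y. (Poly_Mapping.lookup x a * Poly_Mapping.lookup y b) \<odot> f a b)"


section \<open>The alphabet and the non-commutative polynomial ring\<close>

text \<open>
  The alphabet \<open>\<A>\<close>: \<open>Diff\<close> stands for \<open>e\<^sub>1 - g\<^sub>1\<close>, and, the index being shifted
  because the \<open>g\<^sub>k\<close> start at \<open>k = 1\<close>, \<open>Gen i\<close> stands for \<open>g\<^bsub>i+1\<^esub>\<close>.
\<close>

datatype letter = Diff | Gen nat

text \<open>Words under concatenation; the wrapper makes the free monoid an (additively written) monoid,
  so that its monoid ring is provided by \<open>Poly_Mapping\<close>.\<close>

datatype 'a word = Word (letters: "'a list")

instantiation word :: (type) monoid_add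
begin

definition zero_word :: "'a word" where
  "zero_word = Word []"

definition plus_word :: "'a word \<Rightarrow> 'a word \<Rightarrow> 'a word" where
  "plus_word v w = Word (letters v @ letters w)"

instance
  by standard (simp_all add: zero_word_def plus_word_def)

end

text \<open>
  The module \<open>\<zz>\<close> and the ring \<open>\<C>\<langle>e\<^sub>1, g\<^sub>1, g\<^sub>2, \<dots>\<rangle>\<close>, the latter presented by its free generating set
  \<open>\<A>\<close>.  Its multiplication \<open>*\<close> is concatenation.
\<close>

type_synonym 'k zmodule = "letter \<Rightarrow>\<^sub>0 'k laurent"
type_synonym 'k free_alg = "letter word \<Rightarrow>\<^sub>0 'k laurent"

definition emb :: "'k::field_char_0 zmodule \<Rightarrow> 'k free_alg" where
  "emb x = (\<Sum>a\<in>Poly_Mapping.keys x. Poly_Mapping.single (Word [a]) (Poly_Mapping.lookup x a))"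

definition diff_elt :: "'k::field_char_0 zmodule" where
  "diff_elt = Poly_Mapping.single Diff 1"

text \<open>Only meaningful for \<open>k \<ge> 1\<close>.\<close>

definition g :: "nat \<Rightarrow> 'k::field_char_0 zmodule" where
  "g k = Poly_Mapping.single (Gen (k - 1)) 1"

definition e :: "nat \<Rightarrow> 'k::field_char_0 zmodule" where
  "e k = (if k = 1 then diff_elt + g 1 else g k + hbar \<odot> g (k - 1))"


section \<open>The product on \<open>\<zz>\<close>\<close>

fun circ_letter :: "letter \<Rightarrow> letter \<Rightarrow> 'k::field_char_0 zmodule" where
  "circ_letter Diff Diff = hbar \<odot> diff_elt"
| "circ_letter Diff (Gen i) = hbar \<odot> g (i + 1)"
| "circ_letter (Gen i) Diff = hbar \<odot> g (i + 1)"
| "circ_letter (Gen i) (Gen j) = g ((i + 1) + (j + 1))"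

definition circ :: "'k::field_char_0 zmodule \<Rightarrow> 'k zmodule \<Rightarrow> 'k zmodule" where
  "circ = bilinear_ext circ_letter"

text \<open>\<open>u\<^sup>\<circ>\<^sup>n\<close>, only meaningful for \<open>n \<ge> 1\<close>.\<close>

definition circ_pow :: "'k::field_char_0 zmodule \<Rightarrow> nat \<Rightarrow> 'k zmodule" where
  "circ_pow u n = ((\<lambda>v. circ v u) ^^ (n - 1)) u"


section \<open>The harmonic product\<close>

text \<open>The recursion acts on the last letters, hence the arguments are the reversed words.\<close>

fun harm_rev :: "letter list \<Rightarrow> letter list \<Rightarrow> 'k::field_char_0 free_alg" where
  "harm_rev [] w' = Poly_Mapping.single (Word (rev w')) 1"
| "harm_rev w [] = Poly_Mapping.single (Word (rev w)) 1"
| "harm_rev (u # w) (v # w') =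
     harm_rev w (v # w') * emb (Poly_Mapping.single u 1)
     + harm_rev (u # w) w' * emb (Poly_Mapping.single v 1)
     + harm_rev w w' * emb (circ_letter u v)"

definition harm :: "'k::field_char_0 free_alg \<Rightarrow> 'k free_alg \<Rightarrow> 'k free_alg" where
  "harm = bilinear_ext (\<lambda>v w. harm_rev (rev (letters v)) (rev (letters w)))"


section \<open>Power series in \<open>X\<close>\<close>

text \<open>
  Infinite sums of power series are taken in the \<open>X\<close>-adic topology, i.e. the metric topology that
  \<open>Formal_Power_Series\<close> puts on \<open>fps\<close>.
\<close>

definition geom_inverse :: "'a::ring_1 fps \<Rightarrow> 'a fps" where
  "geom_inverse f = (\<Sum>\<^sub>\<infinity>n. (- f) ^ n)"

definition harm_fps ::
  "'k::field_char_0 free_alg fps \<Rightarrow> 'k free_alg fps \<Rightarrow> 'k free_alg fps" where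
  "harm_fps f f' = Abs_fps (\<lambda>n. \<Sum>i=0..n. harm (fps_nth f i) (fps_nth f' (n - i)))"

primrec harm_power :: "'k::field_char_0 free_alg fps \<Rightarrow> nat \<Rightarrow> 'k free_alg fps" where
  "harm_power f 0 = 1"
| "harm_power f (Suc n) = harm_fps (harm_power f n) f"

definition scalar_fps :: "'k::field_char_0 fps \<Rightarrow> 'k free_alg fps" where
  "scalar_fps p = Abs_fps (\<lambda>n. const (fps_nth p n) \<odot> 1)"

definition harm_exp :: "'k::field_char_0 free_alg fps \<Rightarrow> 'k free_alg fps" where
  "harm_exp f = 1 + (\<Sum>\<^sub>\<infinity>n\<in>{1..}. fps_const (const (1 / fact n) \<odot> 1) * harm_power f n)"


section \<open>The elements \<open>\<phi>\<^sub>k\<close>, the series \<open>\<phi>(\<theta>; x)\<close> and roots of unity\<close>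

definition phi :: "nat \<Rightarrow> 'k::field_char_0 zmodule" where
  "phi k = (\<Sum>j=1..k. (of_nat (fact (j - 1) * Stirling k j) * hbar_pow (int k - int j)) \<odot> g j)"

definition varphi :: "'k::field_char_0 \<Rightarrow> 'k fps" where
  "varphi \<theta> = Abs_fps (\<lambda>k. if k = 0 then 0
     else (\<Prod>a=1..k-1. of_nat k * \<theta> - of_nat a) / fact k)"

definition root_of_unity :: "nat \<Rightarrow> complex" where
  "root_of_unity M = exp (2 * of_real pi * \<i> / of_nat M)"


section \<open>Characterising properties of these definitions\<close>

lemma single_sum_induct [case_names single sum]:
  fixes x :: "'a \<Rightarrow>\<^sub>0 'c::comm_monoid_add"
  assumes single: "\<And>k v. P (Poly_Mapping.single k v)"
    and sum: "\<And>f h. P f \<Longrightarrow> P h \<Longrightarrow> P (f + h)"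
  shows "P x"
proof -
  have "P (\<Sum>a\<in>A. Poly_Mapping.single a (Poly_Mapping.lookup x a))" for A
    by (induction A rule: infinite_finite_induct) (use single[of _ 0] single sum in auto)
  then have "P (\<Sum>a\<in>Poly_Mapping.keys x. Poly_Mapping.single a (Poly_Mapping.lookup x a))" .
  also have "(\<Sum>a\<in>Poly_Mapping.keys x. Poly_Mapping.single a (Poly_Mapping.lookup x a)) = x"
    by (rule poly_mapping_eqI)
      (simp add: lookup_sum lookup_single when_def in_keys_iff)
  finally show ?thesis .
qed

lemma lookup_smul [simp]: "Poly_Mapping.lookup (c \<odot> x) a = c * Poly_Mapping.lookup x a"
  by (cases "Poly_Mapping.lookup x a = 0") (simp_all add: smul_def Poly_Mapping.map.rep_eq when_def)

lemma smul_add_right: "c \<odot> (x + y) = c \<odot> x + c \<odot> y"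
  by (rule poly_mapping_eqI) (simp add: lookup_add algebra_simps)

lemma smul_add_left: "(c + d) \<odot> x = c \<odot> x + d \<odot> x"
  by (rule poly_mapping_eqI) (simp add: lookup_add algebra_simps)

lemma smul_smul: "c \<odot> d \<odot> x = (c * d) \<odot> x"
  by (rule poly_mapping_eqI) (simp add: algebra_simps)

lemma smul_zero_left [simp]: "0 \<odot> x = 0"
  by (rule poly_mapping_eqI) simp

lemma smul_zero_right [simp]: "c \<odot> 0 = 0"
  by (rule poly_mapping_eqI) simp

lemma smul_one [simp]: "(1::'c::semiring_1) \<odot> x = x"
  by (rule poly_mapping_eqI) simp

lemma smul_sum: "c \<odot> sum f A = (\<Sum>a\<in>A. c \<odot> f a)"
  by (induction A rule: infinite_finite_induct) (simp_all add: smul_add_right)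

lemma smul_single [simp]: "c \<odot> Poly_Mapping.single a d = Poly_Mapping.single a (c * d)"
  by (rule poly_mapping_eqI) (simp add: lookup_single when_def)

lemma smul_mult_left: "(c \<odot> x) * y = c \<odot> (x * (y :: 'a::monoid_add \<Rightarrow>\<^sub>0 'c::comm_semiring_1))"
proof -
  have eq: "c \<odot> z = Poly_Mapping.single 0 c * z" for z :: "'a \<Rightarrow>\<^sub>0 'c"
  proof (induction z rule: single_sum_induct)
    case (single k v)
    then show ?case by (simp add: mult_single)
  next
    case (sum f h)
    then show ?case by (simp only: smul_add_right distrib_left)
  qed
  show ?thesis by (simp add: eq mult.assoc)
qed

lemma bilinear_ext_superset:
  assumes "finite A" "finite B" "Poly_Mapping.keys x \<subseteq> A" "Poly_Mapping.keys y \<subseteq> B"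
  shows "bilinear_ext f x y = (\<Sum>a\<in>A. \<Sum>b\<in>B. (Poly_Mapping.lookup x a * Poly_Mapping.lookup y b) \<odot> f a b)"
proof -
  have "bilinear_ext f x y = (\<Sum>a\<in>Poly_Mapping.keys x. \<Sum>b\<in>B. (Poly_Mapping.lookup x a * Poly_Mapping.lookup y b) \<odot> f a b)"
    unfolding bilinear_ext_def using assms
    by (intro sum.cong[OF refl] sum.mono_neutral_left) (auto simp: in_keys_iff)
  also have "\<dots> = (\<Sum>a\<in>A. \<Sum>b\<in>B. (Poly_Mapping.lookup x a * Poly_Mapping.lookup y b) \<odot> f a b)"
    using assms by (intro sum.mono_neutral_left) (auto simp: in_keys_iff)
  finally show ?thesis .
qed

lemma bilinear_ext_add_left:
  "bilinear_ext f (x + x') y = bilinear_ext f x y + bilinear_ext f x' y"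
proof -
  let ?A = "Poly_Mapping.keys x \<union> Poly_Mapping.keys x'"
  have "Poly_Mapping.keys (x + x') \<subseteq> ?A" by (rule keys_add)
  then show ?thesis
    by (simp add: bilinear_ext_superset[of ?A "Poly_Mapping.keys y"] lookup_add distrib_right
        smul_add_left sum.distrib)
qed

lemma bilinear_ext_add_right:
  "bilinear_ext f x (y + y') = bilinear_ext f x y + bilinear_ext f x y'"
proof -
  let ?B = "Poly_Mapping.keys y \<union> Poly_Mapping.keys y'"
  have "Poly_Mapping.keys (y + y') \<subseteq> ?B" by (rule keys_add)
  then show ?thesis
    by (simp add: bilinear_ext_superset[of "Poly_Mapping.keys x" ?B] lookup_add distrib_left
        smul_add_left sum.distrib)
qed

lemma bilinear_ext_smul_left: "bilinear_ext f (c \<odot> x) y = c \<odot> bilinear_ext f x y"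
proof -
  have "Poly_Mapping.keys (c \<odot> x) \<subseteq> Poly_Mapping.keys x" by (auto simp: in_keys_iff)
  then show ?thesis
    by (simp add: bilinear_ext_superset[of "Poly_Mapping.keys x" "Poly_Mapping.keys y"] smul_sum smul_smul mult.assoc)
qed

lemma bilinear_ext_smul_right: "bilinear_ext f x (c \<odot> y) = c \<odot> bilinear_ext f x y"
proof -
  have "Poly_Mapping.keys (c \<odot> y) \<subseteq> Poly_Mapping.keys y" by (auto simp: in_keys_iff)
  then show ?thesis
    by (simp add: bilinear_ext_superset[of "Poly_Mapping.keys x" "Poly_Mapping.keys y"] smul_sum smul_smul mult.left_commute)
qed

lemma bilinear_ext_zero [simp]: "bilinear_ext f 0 y = 0" "bilinear_ext f x 0 = 0"
  by (simp_all add: bilinear_ext_def)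

lemma bilinear_ext_single:
  "bilinear_ext f (Poly_Mapping.single a c) (Poly_Mapping.single b d) = (c * d) \<odot> f a b"
  by (simp add: bilinear_ext_superset[of "{a}" "{b}"])

lemma circ_diff_diff: "circ diff_elt diff_elt = hbar \<odot> diff_elt"
  by (simp add: circ_def diff_elt_def bilinear_ext_single)

lemma circ_diff_g: "k \<ge> 1 \<Longrightarrow> circ diff_elt (g k) = hbar \<odot> g k"
  by (simp add: circ_def diff_elt_def g_def bilinear_ext_single)

lemma circ_g_diff: "k \<ge> 1 \<Longrightarrow> circ (g k) diff_elt = hbar \<odot> g k"
  by (simp add: circ_def diff_elt_def g_def bilinear_ext_single)

lemma circ_g_g: "k \<ge> 1 \<Longrightarrow> l \<ge> 1 \<Longrightarrow> circ (g k) (g l) = g (k + l)"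
  by (simp add: circ_def g_def bilinear_ext_single)

lemma emb_single: "emb (Poly_Mapping.single u c) = Poly_Mapping.single (Word [u]) c"
  by (simp add: emb_def)

lemma one_free_alg: "1 = Poly_Mapping.single (Word []) 1"
  unfolding single_one[symmetric] zero_word_def ..

lemma harm_rev_Nil_right: "harm_rev w [] = Poly_Mapping.single (Word (rev w)) 1"
  by (cases w) simp_all

lemma harm_one_right: "harm w 1 = w"
proof (induction w rule: single_sum_induct)
  case (single k v)
  then show ?case
    by (simp add: harm_def one_free_alg bilinear_ext_single harm_rev_Nil_right)
next
  case (sum f h)
  then show ?case by (simp add: harm_def bilinear_ext_add_left)
qed

lemma harm_one_left: "harm 1 w = w"
proof (induction w rule: single_sum_induct)
  case (single k v)
  then show ?case
    by (simp add: harm_def one_free_alg bilinear_ext_single)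
next
  case (sum f h)
  then show ?case by (simp add: harm_def bilinear_ext_add_right)
qed

text \<open>The defining recursion of the harmonic product, for arbitrary elements \<open>w\<close>, \<open>w'\<close> of the
  ring and letters \<open>u\<close>, \<open>v\<close>.\<close>

lemma harm_recursion:
  fixes w w' :: "'k::field_char_0 free_alg" and u v :: letter
  defines "U \<equiv> Poly_Mapping.single u 1" and "V \<equiv> Poly_Mapping.single v 1"
  shows "harm (w * emb U) (w' * emb V) =
    harm w (w' * emb V) * emb U + harm (w * emb U) w' * emb V + harm w w' * emb (circ U V)"
proof (induction w rule: single_sum_induct)
  case (single k c)
  show ?case
  proof (induction w' rule: single_sum_induct)
    case (single l d)
    have circ: "circ U V = circ_letter u v"
      by (simp add: U_def V_def circ_def bilinear_ext_single)
    show ?case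
      unfolding circ
      by (simp add: U_def V_def emb_single mult_single harm_def bilinear_ext_single plus_word_def
          smul_add_right smul_mult_left)
  next
    case (sum f h)
    then show ?case
      by (simp add: harm_def bilinear_ext_add_right algebra_simps)
  qed
next
  case (sum f h)
  then show ?case
    by (simp add: harm_def bilinear_ext_add_left algebra_simps)
qed

text \<open>The infinite sums above are, coefficientwise, finite sums.\<close>

lemma fps_nth_infsum:
  fixes F :: "nat \<Rightarrow> 'a::ab_group_add fps"
  assumes "\<And>k n. k \<in> A \<Longrightarrow> n < k \<Longrightarrow> fps_nth (F k) n = 0"
  shows "fps_nth (\<Sum>\<^sub>\<infinity>k\<in>A. F k) n = (\<Sum>k | k \<in> A \<and> k \<le> n. fps_nth (F k) n)"
proof -
  define S where "S = Abs_fps (\<lambda>n. \<Sum>k | k \<in> A \<and> k \<le> n. fps_nth (F k) n)"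
  have nth: "fps_nth (sum F B) n = fps_nth S n"
    if B: "finite B" "B \<subseteq> A" "{k \<in> A. k \<le> N} \<subseteq> B" and n: "n \<le> N" for B n N
  proof -
    have "fps_nth (sum F B) n = (\<Sum>k\<in>B. fps_nth (F k) n)"
      by (simp add: fps_sum_nth)
    also have "\<dots> = (\<Sum>k | k \<in> A \<and> k \<le> n. fps_nth (F k) n)"
    proof (intro sum.mono_neutral_right ballI)
      fix k assume "k \<in> B - {k. k \<in> A \<and> k \<le> n}"
      with B(2) have "k \<in> A" "n < k" by auto
      then show "fps_nth (F k) n = 0" by (rule assms)
    qed (use B n in auto)
    finally show ?thesis by (simp add: S_def)
  qed
  have "(F has_sum S) A"
    unfolding has_sum_def tendsto_iff
  proof (intro allI impI)
    fix r :: real assume "r > 0"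
    have "\<exists>N. inverse 2 ^ N < r"
      using \<open>r > 0\<close> by (intro real_arch_pow_inv) simp_all
    then obtain N where N: "inverse (2 ^ N) < r"
      unfolding power_inverse by blast
    have "dist (sum F B) S < r" if B: "finite B" "B \<subseteq> A" "{k \<in> A. k \<le> N} \<subseteq> B" for B
    proof (cases "sum F B = S")
      case False
      have "subdegree (sum F B - S) > N"
      proof (rule ccontr)
        assume "\<not> subdegree (sum F B - S) > N"
        then have "fps_nth (sum F B - S) (subdegree (sum F B - S)) = 0"
          using nth[OF B] by simp
        moreover have "sum F B - S \<noteq> 0" using False by simp
        ultimately show False using nth_subdegree_nonzero by blast
      qed
      then have "inverse (2 ^ subdegree (sum F B - S)) \<le> (inverse (2 ^ N) :: real)"
        by (intro le_imp_inverse_le power_increasing) simp_all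
      moreover have "dist (sum F B) S = inverse (2 ^ subdegree (sum F B - S))"
        unfolding dist_fps_def using False by (simp only: if_False)
      ultimately show ?thesis using N by linarith
    qed (use \<open>r > 0\<close> in simp)
    then show "eventually (\<lambda>B. dist (sum F B) S < r) (finite_subsets_at_top A)"
      unfolding eventually_finite_subsets_at_top
      by (intro exI[of _ "{k \<in> A. k \<le> N}"]) auto
  qed
  then show ?thesis by (simp add: infsumI S_def)
qed

end

theory Submission
  imports Defs "HOL-Computational_Algebra.Polynomial"
begin

text \<open>
  Let \<open>v = \<hbar>\<^sup>-\<^sup>N\<^sup>L e\<^sub>N\<^sup>\<circ>\<^sup>L\<close> and \<open>M = NL\<close>.  Applying the derivation \<open>X d/dX\<close> shows that
  \<open>1 / (1 + v X\<^sup>M)\<close> is the harmonic exponential of \<open>- \<Sum>\<^sub>n v\<^sup>\<circ>\<^sup>n X\<^sup>M\<^sup>n / n\<close>: both sides satisfy the same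
  first-order recurrence.  It only involves harmonic multiplication by elements of \<open>\<zz>\<close>, and these
  operators commute, so that associativity of the harmonic product is not needed.

  To identify the exponents, the generating function of the Stirling numbers turns the coefficient
  of \<open>- \<hbar>\<^sup>-\<^sup>j g\<^sub>j\<close> on the right into the sum of \<open>(exp \<phi> - 1)\<^sup>j / j\<close> over the substitutions
  of \<open>\<epsilon> X\<close> for \<open>x\<close>, where \<open>\<epsilon>\<^sup>M = 1\<close>.
  The series \<open>w = exp \<phi>(\<theta>; x) - 1\<close> is the solution of \<open>w = x (1 + w)\<^sup>\<theta>\<close>, so Lagrange inversion gives
  its powers, and for \<open>\<theta> = 1/N\<close> their coefficients are the binomial coefficients in the
  \<open>\<circ>\<close>-powers of \<open>e\<^sub>N = g\<^sub>N + \<hbar> g\<^bsub>N-1\<^esub>\<close>.  The term \<open>k = 1\<close> may be omitted because \<open>\<phi>(1/N; x)\<close> has no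
  monomials \<open>x\<^sup>d\<close> with \<open>N\<close> dividing \<open>d\<close>.
\<close>

unbundle fps_syntax

section \<open>Lagrange inversion and the series \<open>\<phi>(\<theta>; x)\<close>\<close>

text \<open>The recurrence of the Stirling numbers gives F_(j+1)' = (j+1) F_(j+1) + F_j for the left
  sides. The right sides satisfy it too, since exp = (exp - 1) + 1. Given F_j, this equation and the
  zero constant term determine F_(j+1), coefficient by coefficient.\<close>

lemma Stirling_egf:
  "Abs_fps (\<lambda>k. of_nat (Stirling k j) / fact k :: 'a::field_char_0)
    = fps_const (1 / fact j) * (fps_exp 1 - 1) ^ j"
proof (induction j)
  case 0
  show ?case
  proof (rule fps_ext)
    fix n show "Abs_fps (\<lambda>k. of_nat (Stirling k 0) / fact k :: 'a) $ n
      = (fps_const (1 / fact 0) * (fps_exp 1 - 1) ^ 0) $ n"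
      by (cases n) simp_all
  qed
next
  case (Suc j)
  define S where "S i = Abs_fps (\<lambda>k. of_nat (Stirling k i) / fact k :: 'a)" for i
  define B where "B i = fps_const (1 / fact i :: 'a) * (fps_exp 1 - 1) ^ i" for i
  have S_deriv: "fps_deriv (S (Suc j)) = of_nat (Suc j) * S (Suc j) + S j"
  proof (rule fps_ext)
    fix n
    have "fps_deriv (S (Suc j)) $ n = of_nat (Stirling (Suc n) (Suc j)) / fact n"
      by (simp add: S_def divide_simps del: of_nat_Suc Stirling.simps)
    also have "\<dots> = (of_nat (Suc j) * S (Suc j) + S j) $ n"
      by (simp add: S_def fps_of_nat[symmetric] add_divide_distrib distrib_right)
    finally show "fps_deriv (S (Suc j)) $ n = (of_nat (Suc j) * S (Suc j) + S j) $ n" .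
  qed
  have B_deriv: "fps_deriv (B (Suc j)) = of_nat (Suc j) * B (Suc j) + B j"
  proof -
    have "fps_deriv (B (Suc j))
        = (fps_const (1 / fact (Suc j)) * of_nat (Suc j)) * (fps_exp 1 - 1) ^ j * fps_exp 1"
      by (simp add: B_def fps_deriv_power' mult_ac del: of_nat_Suc fact_Suc power_Suc)
    also have "fps_const (1 / fact (Suc j)) * of_nat (Suc j) = fps_const (1 / fact j :: 'a)"
      by (simp add: fps_of_nat[symmetric] del: of_nat_Suc)
    also have "fps_const (1 / fact j) * (fps_exp 1 - 1) ^ j * fps_exp 1
        = fps_const (1 / fact j) * (fps_exp 1 - 1) ^ Suc j + B j"
      by (simp add: B_def algebra_simps)
    also have "fps_const (1 / fact j :: 'a) = of_nat (Suc j) * fps_const (1 / fact (Suc j))"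
      by (simp add: fps_of_nat[symmetric] del: of_nat_Suc)
    finally show ?thesis
      by (simp only: B_def mult.assoc)
  qed
  have "S (Suc j) $ n = B (Suc j) $ n" for n
  proof (induction n)
    case 0
    show ?case by (simp add: S_def B_def fps_power_zeroth)
  next
    case (Suc n)
    have "of_nat (Suc n) * S (Suc j) $ Suc n = fps_deriv (S (Suc j)) $ n" by simp
    also have "\<dots> = fps_deriv (B (Suc j)) $ n"
      using Suc \<open>Abs_fps _ = _\<close>[folded S_def B_def]
      by (simp add: S_deriv B_deriv fps_of_nat[symmetric])
    also have "\<dots> = of_nat (Suc n) * B (Suc j) $ Suc n" by simp
    finally show ?case by (simp del: of_nat_Suc)
  qed
  then show ?case by (simp add: S_def B_def fps_eq_iff)
qed

text \<open>Trades a sum over all powers of \<open>p\<close> for a single power of exp p - 1, which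
  Lagrange inversion can handle.\<close>

lemma Stirling_egf_compose:
  fixes p :: "'a::field_char_0 fps"
  assumes "p $ 0 = 0"
  shows "(\<Sum>k=0..n. of_nat (Stirling k j) / fact k * (p ^ k) $ n)
    = (1 / fact j) * (((fps_exp 1 oo p) - 1) ^ j) $ n"
proof -
  have "(\<Sum>k=0..n. of_nat (Stirling k j) / fact k * (p ^ k) $ n)
      = ((fps_const (1 / fact j) * (fps_exp 1 - 1) ^ j) oo p) $ n"
    by (simp add: fps_compose_nth flip: Stirling_egf)
  also have "(fps_const (1 / fact j) * (fps_exp 1 - 1) ^ j) oo p
      = fps_const (1 / fact j) * ((fps_exp 1 oo p) - 1) ^ j"
    using assms by (simp add: fps_compose_mult_distrib fps_compose_sub_distrib flip: fps_compose_power)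
  finally show ?thesis by simp
qed

text \<open>Since \<open>a ^ i\<close> has order at least i, each coefficient of the composition up
  to degree n may be summed over the common range i \<le> n, and the two sums can be
  interchanged.\<close>

lemma fps_compose_mult_nth:
  fixes a :: "'a::idom fps"
  assumes "a $ 0 = 0"
  shows "((K oo a) * Z) $ n = (\<Sum>i=0..n. K $ i * (a ^ i * Z) $ n)"
proof -
  have "(K oo a) $ j = (\<Sum>i=0..n. K $ i * (a ^ i) $ j)" if "j \<le> n" for j
    unfolding fps_compose_nth
    by (rule sum.mono_neutral_left) (use that startsby_zero_power_prefix[OF assms] in auto)
  then have "((K oo a) * Z) $ n = (\<Sum>j=0..n. \<Sum>i=0..n. K $ i * (a ^ i) $ j * Z $ (n - j))"
    by (simp add: fps_mult_nth sum_distrib_right)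
  also have "\<dots> = (\<Sum>i=0..n. \<Sum>j=0..n. K $ i * (a ^ i) $ j * Z $ (n - j))"
    by (rule sum.swap)
  finally show ?thesis
    by (simp add: fps_mult_nth sum_distrib_left mult.assoc)
qed

text \<open>The coefficient below is the residue of \<open>a\<^sup>i a' / a\<^sup>n\<close>.\<close>

lemma fps_residue_power:
  fixes \<psi> :: "'a::field_char_0 fps"
  assumes psi: "\<psi> $ 0 = 1" and i: "i < n"
  defines "a \<equiv> fps_X * \<psi>"
  shows "(a ^ i * (fps_deriv a * inverse \<psi> ^ n)) $ (n - 1) = (if Suc i = n then 1 else 0)"
proof -
  define \<phi> where "\<phi> = inverse \<psi>"
  define m where "m = n - Suc i"
  have n: "n = Suc i + m" using i by (simp add: m_def)
  have inv: "\<psi> * \<phi> = 1"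
    using psi by (simp add: \<phi>_def inverse_mult_eq_1')
  have inv_pow: "\<psi> ^ k * \<phi> ^ k = 1" for k
    using inv by (simp flip: power_mult_distrib)
  \<comment> \<open>Here a' = \<psi> + X \<psi>'. Writing n = i + 1 + m, all factors \<psi> outside
    \<psi>' cancel, and the coefficient at n - 1 = i + m becomes the one at m after removing
    X^i.\<close>
  have "a ^ i * (fps_deriv a * \<phi> ^ n)
      = fps_X ^ i * ((\<psi> ^ Suc i * \<phi> ^ Suc i) * \<phi> ^ m
          + fps_X * fps_deriv \<psi> * (\<psi> ^ i * \<phi> ^ i) * \<phi> ^ Suc m)"
    by (simp add: a_def n power_add algebra_simps)
  also have "\<dots> = fps_X ^ i * (\<phi> ^ m + fps_X * fps_deriv \<psi> * \<phi> ^ Suc m)"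
    by (simp only: inv_pow mult_1_left mult_1_right)
  finally have "(a ^ i * (fps_deriv a * \<phi> ^ n)) $ (n - 1)
      = (\<phi> ^ m + fps_X * fps_deriv \<psi> * \<phi> ^ Suc m) $ m" (is "_ = ?Q $ m")
    by (simp add: n fps_X_power_mult_nth)
  also have "\<dots> = (if m = 0 then 1 else 0)"
  proof (cases m)
    case 0
    then show ?thesis by simp
  next
    case (Suc m')
    have "fps_deriv \<phi> = - fps_deriv \<psi> * \<phi>\<^sup>2"
      unfolding \<phi>_def using psi by (subst fps_inverse_deriv) simp_all
    then have deriv: "fps_deriv (\<phi> ^ m) = - (of_nat m * \<phi> ^ m' * (fps_deriv \<psi> * \<phi>\<^sup>2))"
      by (simp add: Suc fps_deriv_power' del: of_nat_Suc power_Suc)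
    \<comment> \<open>The operator X d/dX multiplies the coefficient at m by m, so the two terms on
      the right cancel there.\<close>
    have "of_nat m * ?Q = of_nat m * \<phi> ^ m - fps_X * fps_deriv (\<phi> ^ m)"
      unfolding deriv by (simp add: Suc algebra_simps power2_eq_square del: of_nat_Suc)
    then have "(of_nat m * ?Q) $ m = 0"
      by (simp add: Suc fps_of_nat[symmetric] del: of_nat_Suc power_Suc)
    then show ?thesis
      using Suc by (simp add: fps_of_nat[symmetric] del: of_nat_Suc)
  qed
  finally show ?thesis
    by (simp add: \<phi>_def n)
qed

text \<open>With a = X \<psi> and K = H o a^(-1), the chain rule expands H' as the series of K'_i
  a^i a'. By \<open>fps_residue_power\<close> the coefficient extraction keeps only i = n - 1, which
  leaves K'_(n-1) = n K_n.\<close>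

lemma fps_Lagrange_inversion:
  fixes \<psi> H :: "'a::field_char_0 fps"
  assumes psi: "\<psi> $ 0 = 1" and n: "n > 0"
  shows "of_nat n * (H oo fps_inv (fps_X * \<psi>)) $ n = (fps_deriv H * inverse \<psi> ^ n) $ (n - 1)"
proof -
  define a where "a = fps_X * \<psi>"
  define K where "K = H oo fps_inv a"
  have a0: "a $ 0 = 0" and a1: "a $ 1 \<noteq> 0"
    using psi by (simp_all add: a_def)
  have "K oo a = H oo (fps_inv a oo a)"
    unfolding K_def by (rule fps_compose_assoc[symmetric]) (simp_all add: a0 fps_inv_def)
  then have H: "H = K oo a"
    using fps_inv[OF a0 a1] by simp
  have "(fps_deriv H * inverse \<psi> ^ n) $ (n - 1)
      = ((fps_deriv K oo a) * (fps_deriv a * inverse \<psi> ^ n)) $ (n - 1)"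
    using fps_compose_deriv[OF a0, of K] by (simp add: H mult.assoc)
  also have "\<dots> = (\<Sum>i=0..n - 1. if i = n - 1 then fps_deriv K $ i else 0)"
    unfolding fps_compose_mult_nth[OF a0]
    by (intro sum.cong refl, unfold a_def, subst fps_residue_power[OF psi]) (use n in auto)
  also have "\<dots> = of_nat n * K $ n"
    using n by simp
  finally show ?thesis by (simp add: K_def a_def)
qed

text \<open>The series 1 + w, with w this inverse, is the generalized binomial series: the solution
  of B = 1 + x B^\<theta>.\<close>

definition tree_series :: "'a::field_char_0 \<Rightarrow> 'a fps" where
  "tree_series \<theta> = fps_inv (fps_X * fps_binomial (- \<theta>))"

lemma inverse_binomial_power:
  "inverse (fps_binomial (- \<theta>)) ^ n = fps_binomial (of_nat n * (\<theta>::'a::field_char_0))"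
proof -
  have "fps_binomial \<theta> * fps_binomial (- \<theta>) = (1 :: 'a fps)"
    by (simp flip: fps_binomial_add_mult)
  then have "inverse (fps_binomial (- \<theta>)) = fps_binomial \<theta>"
    by (metis fps_inverse_unique mult.commute)
  then show ?thesis by (simp add: fps_binomial_power)
qed

text \<open>Lagrange inversion with H = X^j: the right side is the coefficient at n - 1 of j X^(j-1)
  (1 + X)^(n \<theta>).\<close>

lemma tree_series_power_nth:
  assumes "n > 0"
  shows "of_nat n * (tree_series \<theta> ^ j) $ n
    = (if j \<le> n then of_nat j * ((of_nat n * (\<theta>::'a::field_char_0)) gchoose (n - j)) else 0)"
proof -
  have "of_nat n * ((fps_X ^ j) oo tree_series \<theta>) $ n
      = (fps_deriv (fps_X ^ j) * inverse (fps_binomial (- \<theta>)) ^ n) $ (n - 1)"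
    unfolding tree_series_def using assms by (intro fps_Lagrange_inversion) simp_all
  moreover have "(fps_X ^ j) oo tree_series \<theta> = tree_series \<theta> ^ j"
    by (simp add: fps_X_power_compose tree_series_def fps_inv_def)
  moreover have "fps_deriv (fps_X ^ j :: 'a fps) = of_nat j * fps_X ^ (j - 1)"
    by (simp add: fps_deriv_power')
  ultimately show ?thesis
    using assms by (cases j; cases n)
      (auto simp: inverse_binomial_power mult.assoc fps_X_power_mult_nth fps_of_nat[symmetric]
        simp del: of_nat_Suc power_Suc)
qed

text \<open>Lagrange inversion with H = log (1 + X), where H' = 1 / (1 + X) lowers the exponent of
  (1 + X)^(n \<theta>) by one. The resulting binomial coefficient is the product in
  \<open>varphi\<close> up to factorials.\<close>

lemma varphi_eq: "varphi \<theta> = fps_ln 1 oo tree_series (\<theta>::'a::field_char_0)"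
proof (rule fps_ext)
  fix n
  show "varphi \<theta> $ n = (fps_ln 1 oo tree_series \<theta>) $ n"
  proof (cases n)
    case 0
    then show ?thesis by (simp add: varphi_def)
  next
    case (Suc m)
    have "of_nat n * (fps_ln 1 oo tree_series \<theta>) $ n
        = (fps_deriv (fps_ln 1) * inverse (fps_binomial (- \<theta>)) ^ n) $ (n - 1)"
      unfolding tree_series_def by (intro fps_Lagrange_inversion) (simp_all add: Suc)
    also have "fps_deriv (fps_ln 1 :: 'a fps) = fps_binomial (- 1)"
      by (simp add: fps_ln_deriv fps_binomial_minus_one)
    also have "(fps_binomial (- 1) * inverse (fps_binomial (- \<theta>)) ^ n) $ (n - 1)
        = (of_nat n * \<theta> - 1) gchoose m"
      by (simp add: inverse_binomial_power Suc del: power_Suc of_nat_Suc flip: fps_binomial_add_mult)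
    also have "\<dots> = (\<Prod>a=1..n - 1. of_nat n * \<theta> - of_nat a) / fact m"
      by (simp add: gbinomial_prod_rev Suc prod.atLeast1_atMost_eq lessThan_atLeast0 diff_diff_eq
          del: of_nat_Suc) (simp add: algebra_simps)
    also have "\<dots> = of_nat n * varphi \<theta> $ n"
      by (simp add: varphi_def Suc del: of_nat_Suc)
    finally show ?thesis
      by (simp add: Suc del: of_nat_Suc)
  qed
qed

lemma exp_varphi: "(fps_exp 1 oo varphi \<theta>) - 1 = tree_series (\<theta>::'a::field_char_0)"
proof -
  have T0: "tree_series \<theta> $ 0 = 0"
    by (simp add: tree_series_def fps_inv_def)
  have "(fps_exp 1 oo varphi \<theta>) - 1 = ((fps_exp 1 - 1) oo fps_ln 1) oo tree_series \<theta>"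
    by (simp add: varphi_eq fps_compose_assoc T0 fps_compose_sub_distrib)
  also have "(fps_exp 1 - 1) oo fps_ln 1 = (fps_X :: 'a fps)"
    unfolding fps_ln_fps_exp_inv[OF one_neq_zero] by (rule fps_inv_right) simp_all
  finally show ?thesis by (simp add: T0)
qed

section \<open>Roots of unity and the coefficients of the exponent\<close>

lemma sum_roots_of_unity:
  assumes "M > 0"
  shows "(\<Sum>m=1..M. (root_of_unity M ^ m) ^ d) = (if M dvd d then of_nat M else 0)"
proof -
  define z where "z = root_of_unity M ^ d"
  have z_cis: "z = cis (2 * pi * real d / real M)"
  proof -
    have "root_of_unity M = cis (2 * pi / real M)"
      by (simp add: root_of_unity_def cis_conv_exp mult_ac)
    then show ?thesis by (simp add: z_def Complex.DeMoivre mult_ac)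
  qed
  have zM: "z ^ M = 1"
    using assms by (simp add: z_cis Complex.DeMoivre cis_multiple_2pi)
  \<comment> \<open>The sum is geometric with ratio z and z^M = 1, so it is nonzero only for z =
    1.\<close>
  have z1: "z = 1 \<longleftrightarrow> M dvd d"
  proof
    assume "z = 1"
    then have "cos (2 * pi * real d / real M) = 1"
      by (metis z_cis cis.simps(1) one_complex.simps(1))
    then obtain n :: int where "2 * pi * real d / real M = of_int n * 2 * pi"
      unfolding cos_one_2pi_int by blast
    then have "real d = of_int n * real M"
      using assms by (simp add: field_simps)
    then have "int d = n * int M"
      by (metis of_int_eq_iff of_int_mult of_int_of_nat_eq)
    then have "int M dvd int d" by simp
    then show "M dvd d" by simp
  next
    assume "M dvd d"
    then obtain q where "d = M * q" by blast
    then show "z = 1"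
      using assms cis_multiple_2pi[of "real q"] by (simp add: z_cis mult.assoc)
  qed
  have "(\<Sum>m=1..M. (root_of_unity M ^ m) ^ d) = (\<Sum>m<M. z ^ Suc m)"
    by (simp only: One_nat_def sum.atLeast1_atMost_eq z_def mult.commute power_mult[symmetric])
  also have "\<dots> = z * (\<Sum>m<M. z ^ m)"
    by (simp add: sum_distrib_left)
  also have "\<dots> = (if M dvd d then of_nat M else 0)"
    using zM z1 by (simp add: sum_gp_strict)
  finally show ?thesis .
qed

text \<open>Substituting \<epsilon>^m X scales the coefficient at d by \<epsilon>^(m d), so summing
  over m applies the character sum above.\<close>

lemma root_of_unity_filter:
  assumes "M > 0"
  shows "(\<Sum>m=1..M. (p oo (fps_const (root_of_unity M ^ m) * fps_X)) ^ k) $ d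
    = (if M dvd d then of_nat M * (p ^ k) $ d else 0)"
proof -
  have "(\<Sum>m=1..M. (p oo (fps_const (root_of_unity M ^ m) * fps_X)) ^ k) $ d
      = (\<Sum>m=1..M. (root_of_unity M ^ m) ^ d) * (p ^ k) $ d"
    by (simp add: fps_sum_nth fps_compose_power sum_distrib_right)
  then show ?thesis
    unfolding sum_roots_of_unity[OF assms] by simp
qed

text \<open>For d = N q > 0 the factor with a = q vanishes, and q lies in the range a < d because N
  \<ge> 2.\<close>

lemma varphi_nth_eq_0:
  assumes "N \<ge> 2" "N dvd d"
  shows "varphi (1 / of_nat N) $ d = (0::'a::field_char_0)"
proof (cases "d = 0")
  case False
  obtain q where d: "d = N * q" using assms by blast
  have "q \<in> {1..d - 1}"
    using assms False d by (cases q; cases N) auto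
  moreover have "of_nat d * (1 / of_nat N) - of_nat q = (0::'a)"
    using assms d by simp
  ultimately have "(\<Prod>a=1..d - 1. of_nat d * (1 / of_nat N) - of_nat a) = (0::'a)"
    by (meson finite_atLeastAtMost prod_zero)
  then show ?thesis by (simp add: varphi_def)
qed (simp add: varphi_def)

text \<open>Up to sign and the factor \<open>hbar_pow (- int j)\<close>, this is the coefficient of
  \<open>g j\<close> at X^d in the exponent of the theorem.\<close>

lemma Stirling_sum_varphi:
  fixes N L d j :: nat
  assumes N: "N \<ge> 2" and L: "L \<ge> 1" and j: "1 \<le> j" "j \<le> d"
  shows "(\<Sum>k=2..d. of_nat (fact (j - 1) * Stirling k j) / fact k *
      (\<Sum>m=1..N*L. (varphi (1 / of_nat N) oo (fps_const (root_of_unity (N*L) ^ m) * fps_X)) ^ k) $ d)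
    = (if N * L dvd d then of_nat (N * L) / of_nat d * of_nat (d div N choose (d - j)) else 0)"
proof (cases "N * L dvd d")
  case False
  then show ?thesis using N L by (simp add: root_of_unity_filter del: One_nat_def)
next
  case True
  define p where "p = (varphi (1 / of_nat N) :: complex fps)"
  have p0: "p $ 0 = 0" by (simp add: p_def varphi_def)
  have Nd: "N dvd d" using True dvd_mult_left by blast
  \<comment> \<open>Adding the terms k = 0 and k = 1 changes nothing: the first has Stirling number
    0 as j \<ge> 1, and the second contains the coefficient of \<phi> at a multiple of N.\<close>
  have "(\<Sum>k=2..d. of_nat (Stirling k j) / fact k * (p ^ k) $ d)
      = (\<Sum>k=0..d. of_nat (Stirling k j) / fact k * (p ^ k) $ d)"
  proof (rule sum.mono_neutral_left)
    show "\<forall>k\<in>{0..d} - {2..d}. of_nat (Stirling k j) / fact k * (p ^ k) $ d = 0"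
    proof
      fix k assume "k \<in> {0..d} - {2..d}"
      then consider "k = 0" | "k = 1" by force
      then show "of_nat (Stirling k j) / fact k * (p ^ k) $ d = 0"
        using j varphi_nth_eq_0[OF N Nd] by cases (auto simp: p_def)
    qed
  qed auto
  also have "\<dots> = 1 / fact j * (tree_series (1 / of_nat N) ^ j) $ d"
    unfolding Stirling_egf_compose[OF p0] by (simp add: p_def exp_varphi)
  finally have sum: "(\<Sum>k=2..d. of_nat (Stirling k j) / fact k * (p ^ k) $ d)
    = 1 / fact j * (tree_series (1 / of_nat N) ^ j) $ d" .
  have "of_nat d * (tree_series (1 / of_nat N) ^ j) $ d
      = of_nat j * ((of_nat d * (1 / of_nat N)) gchoose (d - j) :: complex)"
    using j by (subst tree_series_power_nth) auto
  \<comment> \<open>As N divides d, the generalized binomial coefficient becomes an ordinary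
    one.\<close>
  also have "of_nat d * (1 / of_nat N) = (of_nat (d div N) :: complex)"
    using Nd N by (auto elim!: dvdE)
  finally have T: "(tree_series (1 / of_nat N) ^ j) $ d
      = of_nat j / of_nat d * (of_nat (d div N choose (d - j)) :: complex)"
    using j by (simp add: binomial_gbinomial field_simps)
  have filter: "(\<Sum>m=1..N*L. (varphi (1 / of_nat N) oo
      (fps_const (root_of_unity (N*L) ^ m) * fps_X)) ^ k) $ d = of_nat (N * L) * (p ^ k) $ d" for k
    unfolding p_def by (subst root_of_unity_filter) (use True N L in auto)
  have "(\<Sum>k=2..d. of_nat (fact (j - 1) * Stirling k j) / fact k *
      (\<Sum>m=1..N*L. (varphi (1 / of_nat N) oo (fps_const (root_of_unity (N*L) ^ m) * fps_X)) ^ k) $ d)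
    = of_nat (N * L) * fact (j - 1) * (\<Sum>k=2..d. of_nat (Stirling k j) / fact k * (p ^ k) $ d)"
    unfolding filter by (simp add: sum_distrib_left mult_ac)
  also have "\<dots> = of_nat (N * L) * (fact (j - 1) / fact j) * (tree_series (1 / of_nat N) ^ j) $ d"
    unfolding sum by simp
  also have "fact (j - 1) / fact j = (1 / of_nat j :: complex)"
    using j by (simp add: fact_reduce[of j])
  finally show ?thesis
    using True j unfolding T by simp
qed

section \<open>The module \<open>\<zz>\<close> and its action by harmonic multiplication\<close>

lemma hbar_pow_mult: "hbar_pow a * hbar_pow b = (hbar_pow (a + b) :: 'k::field_char_0 laurent)"
  by (simp add: hbar_pow_def mult_single)

lemma hbar_pow_power: "hbar_pow a ^ n = (hbar_pow (int n * a) :: 'k::field_char_0 laurent)"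
  by (induction n) (simp_all add: hbar_pow_mult algebra_simps, simp add: hbar_pow_def)

lemma const_mult: "const a * const b = (const (a * b) :: 'k::field_char_0 laurent)"
  by (simp add: const_def mult_single)

lemma const_1 [simp]: "const 1 = (1 :: 'k::field_char_0 laurent)"
  by (simp add: const_def)

lemma const_0 [simp]: "const 0 = (0 :: 'k::field_char_0 laurent)"
  by (simp add: const_def)

lemma const_add: "const (a + b) = (const a + const b :: 'k::field_char_0 laurent)"
  by (simp add: const_def single_add)

lemma const_sum: "const (sum f A) = (\<Sum>a\<in>A. const (f a) :: 'k::field_char_0 laurent)"
  by (induction A rule: infinite_finite_induct) (simp_all add: const_add)

lemma const_of_nat: "const (of_nat n) = (of_nat n :: 'k::field_char_0 laurent)"
  by (induction n) (simp_all add: const_add)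

lemma sum_smul: "sum f A \<odot> x = (\<Sum>a\<in>A. f a \<odot> x)"
  by (induction A rule: infinite_finite_induct) (simp_all add: smul_add_left)

lemma smul_uminus_right: "c \<odot> (- x) = - (c \<odot> x :: 'a \<Rightarrow>\<^sub>0 'c::ring)"
  by (rule poly_mapping_eqI) simp

lemma emb_superset:
  assumes "finite A" "Poly_Mapping.keys x \<subseteq> A"
  shows "emb x = (\<Sum>a\<in>A. Poly_Mapping.single (Word [a]) (Poly_Mapping.lookup x a))"
  unfolding emb_def using assms by (intro sum.mono_neutral_left) (auto simp: in_keys_iff)

lemma emb_add: "emb (x + y) = emb x + emb y"
proof -
  let ?A = "Poly_Mapping.keys x \<union> Poly_Mapping.keys y"
  have "Poly_Mapping.keys (x + y) \<subseteq> ?A" by (rule keys_add)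
  then show ?thesis
    by (simp add: emb_superset[of ?A] lookup_add single_add sum.distrib)
qed

lemma emb_smul: "emb (c \<odot> x) = c \<odot> emb x"
proof -
  have "Poly_Mapping.keys (c \<odot> x) \<subseteq> Poly_Mapping.keys x" by (auto simp: in_keys_iff)
  then show ?thesis
    by (simp add: emb_superset[of "Poly_Mapping.keys x"] smul_sum)
qed

lemma emb_0 [simp]: "emb 0 = 0"
  by (simp add: emb_def)

lemma emb_uminus: "emb (- x) = - emb x"
  using emb_add[of x "- x"] by (simp add: eq_neg_iff_add_eq_0 add.commute)

lemma emb_sum: "emb (sum f A) = (\<Sum>a\<in>A. emb (f a))"
  by (induction A rule: infinite_finite_induct) (simp_all add: emb_add)

text \<open>Scaling is multiplication by a multiple of the unit, which is central even though the
  ring is not commutative.\<close>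

lemma smul_mult_right: "x * (c \<odot> y) = c \<odot> (x * (y :: 'a::monoid_add \<Rightarrow>\<^sub>0 'c::comm_semiring_1))"
proof -
  have "Poly_Mapping.single 0 c * z = z * Poly_Mapping.single 0 c" for z :: "'a \<Rightarrow>\<^sub>0 'c"
    by (induction z rule: single_sum_induct)
      (simp_all add: mult_single mult.commute algebra_simps)
  moreover have "c \<odot> z = Poly_Mapping.single 0 c * z" for z :: "'a \<Rightarrow>\<^sub>0 'c"
    using smul_mult_left[of c "Poly_Mapping.single 0 1" z, unfolded smul_single] by simp
  ultimately show ?thesis by (metis mult.assoc)
qed

section \<open>The circle product: bilinearity, commutativity, associativity\<close>

lemma circ_add_left: "circ (x + x') y = circ x y + circ x' y"
  by (simp add: circ_def bilinear_ext_add_left)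

lemma circ_add_right: "circ x (y + y') = circ x y + circ x y'"
  by (simp add: circ_def bilinear_ext_add_right)

lemma circ_smul_left: "circ (c \<odot> x) y = c \<odot> circ x y"
  by (simp add: circ_def bilinear_ext_smul_left)

lemma circ_smul_right: "circ x (c \<odot> y) = c \<odot> circ x y"
  by (simp add: circ_def bilinear_ext_smul_right)

lemma circ_zero [simp]: "circ 0 y = 0" "circ x 0 = 0"
  by (simp_all add: circ_def)

lemma circ_sum_left: "circ (sum f A) y = (\<Sum>a\<in>A. circ (f a) y)"
  by (induction A rule: infinite_finite_induct) (simp_all add: circ_add_left)

lemma circ_sum_right: "circ x (sum f A) = (\<Sum>a\<in>A. circ x (f a))"
  by (induction A rule: infinite_finite_induct) (simp_all add: circ_add_right)

lemma zmodule_induct [case_names letter add smul]: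
  fixes x :: "'k::field_char_0 zmodule"
  assumes letter: "\<And>u. P (Poly_Mapping.single u 1)"
    and add: "\<And>x y. P x \<Longrightarrow> P y \<Longrightarrow> P (x + y)"
    and smul: "\<And>c x. P x \<Longrightarrow> P (c \<odot> x)"
  shows "P x"
proof (induction x rule: single_sum_induct)
  case (single k v)
  show ?case using smul[OF letter, of v k] by simp
next
  case (sum f h)
  then show ?case by (rule add)
qed

lemma single_Diff: "Poly_Mapping.single Diff 1 = diff_elt"
  by (simp add: diff_elt_def)

lemma single_Gen: "Poly_Mapping.single (Gen i) 1 = g (Suc i)"
  by (simp add: g_def)

lemma circ_commute: "circ x y = circ y x"
proof (induction x rule: zmodule_induct)
  case (letter u)
  show ?case
  proof (induction y rule: zmodule_induct)
    case (letter v)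
    show ?case
      by (cases u; cases v)
        (simp_all add: single_Diff single_Gen circ_diff_g circ_g_diff circ_g_g add.commute)
  qed (simp_all add: circ_add_left circ_add_right circ_smul_left circ_smul_right)
qed (simp_all add: circ_add_left circ_add_right circ_smul_left circ_smul_right)

text \<open>Combines associativity and commutativity in the shape that arises when two elements are
  multiplied successively onto a word.\<close>

lemma circ_right_commute: "circ (circ x y) z = circ (circ x z) y"
proof (induction x rule: zmodule_induct)
  case (letter u)
  show ?case
  proof (induction y rule: zmodule_induct)
    case (letter v)
    show ?case
    proof (induction z rule: zmodule_induct)
      case (letter w)
      show ?case
        by (cases u; cases v; cases w)
          (simp_all add: single_Diff single_Gen circ_diff_diff circ_diff_g circ_g_diff circ_g_g
            circ_smul_left add.commute add.left_commute)
    qed (simp_all add: circ_add_left circ_add_right circ_smul_left circ_smul_right)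
  qed (simp_all add: circ_add_left circ_add_right circ_smul_left circ_smul_right)
qed (simp_all add: circ_add_left circ_add_right circ_smul_left circ_smul_right)

lemma circ_pow_1: "circ_pow u 1 = u"
  by (simp add: circ_pow_def)

lemma circ_pow_Suc: "n > 0 \<Longrightarrow> circ_pow u (Suc n) = circ (circ_pow u n) u"
  by (cases n) (simp_all add: circ_pow_def)

section \<open>Harmonic multiplication by elements of the letter module\<close>

lemma harm_add_left: "harm (x + x') y = harm x y + harm x' y"
  by (simp add: harm_def bilinear_ext_add_left)

lemma harm_add_right: "harm x (y + y') = harm x y + harm x y'"
  by (simp add: harm_def bilinear_ext_add_right)

lemma harm_smul_left: "harm (c \<odot> x) y = c \<odot> harm x y"
  by (simp add: harm_def bilinear_ext_smul_left)

lemma harm_smul_right: "harm x (c \<odot> y) = c \<odot> harm x y"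
  by (simp add: harm_def bilinear_ext_smul_right)

lemma harm_zero [simp]: "harm 0 y = 0" "harm x 0 = 0"
  by (simp_all add: harm_def)

lemma harm_sum_left: "harm (sum f A) y = (\<Sum>a\<in>A. harm (f a) y)"
  by (induction A rule: infinite_finite_induct) (simp_all add: harm_add_left)

text \<open>Words grow at their right end, matching the recursion of the harmonic product on last
  letters.\<close>

lemma free_alg_induct [case_names one snoc add smul]:
  fixes x :: "'k::field_char_0 free_alg"
  assumes one: "P 1"
    and snoc: "\<And>w u. P w \<Longrightarrow> P (w * emb (Poly_Mapping.single u 1))"
    and add: "\<And>x y. P x \<Longrightarrow> P y \<Longrightarrow> P (x + y)"
    and smul: "\<And>c x. P x \<Longrightarrow> P (c \<odot> x)"
  shows "P x"
proof (induction x rule: single_sum_induct)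
  case (single k v)
  obtain xs where k: "k = Word xs" by (cases k)
  have "P (Poly_Mapping.single (Word xs) 1)"
  proof (induction xs rule: rev_induct)
    case Nil
    then show ?case using one by (simp add: one_free_alg)
  next
    case (snoc u xs)
    from assms(2)[OF snoc, of u] show ?case
      by (simp add: emb_single mult_single plus_word_def)
  qed
  from smul[OF this, of v] show ?case by (simp add: k)
next
  case (sum f h)
  then show ?case by (rule add)
qed

text \<open>The defining recursion with w' = 1, extended bilinearly from letters to the whole
  module.\<close>

lemma harm_snoc_emb:
  "harm (w * emb x) (emb y) = harm w (emb y) * emb x + w * emb x * emb y + w * emb (circ x y)"
proof (induction x rule: zmodule_induct)
  case (letter u)
  show ?case
  proof (induction y rule: zmodule_induct)
    case (letter v)
    show ?case
      using harm_recursion[of w u 1 v] by (simp add: harm_one_right)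
  qed (simp_all add: emb_add emb_smul harm_add_right harm_smul_right circ_add_right circ_smul_right
      distrib_left distrib_right smul_mult_left smul_mult_right smul_add_right add_ac)
qed (simp_all add: emb_add emb_smul harm_add_left harm_smul_left circ_add_left circ_smul_left
    distrib_left distrib_right smul_mult_left smul_mult_right smul_add_right add_ac)

text \<open>Expanding both products by \<open>harm_snoc_emb\<close> on the last letter of w gives
  terms that are permuted by exchanging x and y, apart from the one covered by the induction
  hypothesis and the ones covered by the laws of \<open>circ\<close>.\<close>

lemma harm_emb_right_commute:
  "harm (harm w (emb x)) (emb y) = harm (harm w (emb y)) (emb x)"
proof (induction w rule: free_alg_induct)
  case one
  show ?case
    using harm_snoc_emb[of 1 x y] harm_snoc_emb[of 1 y x]
    by (simp add: harm_one_left circ_commute add_ac)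
next
  case (snoc w u)
  then show ?case
    by (simp add: harm_snoc_emb harm_add_left distrib_right circ_commute[of x y]
        circ_right_commute[of _ x y] add_ac)
qed (simp_all add: harm_add_left harm_smul_left)


section \<open>Circle powers of \<open>e N\<close>, computed in a polynomial ring\<close>

definition poly_zmod :: "'k::field_char_0 laurent poly \<Rightarrow> 'k zmodule" where
  "poly_zmod P = (\<Sum>k=1..degree P. coeff P k \<odot> g k)"

lemma poly_zmod_superset:
  assumes "degree P \<le> n"
  shows "poly_zmod P = (\<Sum>k=1..n. coeff P k \<odot> g k)"
  unfolding poly_zmod_def
  by (rule sum.mono_neutral_left) (use assms in \<open>auto simp: coeff_eq_0\<close>)

lemma poly_zmod_add: "poly_zmod (P + Q) = poly_zmod P + poly_zmod Q"
proof -
  let ?n = "max (degree P) (degree Q)"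
  have "degree (P + Q) \<le> ?n" by (rule degree_add_le_max)
  then show ?thesis
    by (simp add: poly_zmod_superset[of _ ?n] smul_add_left sum.distrib)
qed

lemma poly_zmod_0 [simp]: "poly_zmod 0 = 0"
  by (simp add: poly_zmod_def)

lemma poly_zmod_sum: "poly_zmod (sum f A) = (\<Sum>a\<in>A. poly_zmod (f a))"
  by (induction A rule: infinite_finite_induct) (simp_all add: poly_zmod_add)

lemma poly_zmod_smult: "poly_zmod (smult c P) = c \<odot> poly_zmod P"
  by (simp add: poly_zmod_superset[OF degree_smult_le] smul_sum smul_smul)
    (simp add: poly_zmod_def smul_sum smul_smul)

lemma poly_zmod_monom:
  assumes "k \<ge> 1"
  shows "poly_zmod (monom c k) = c \<odot> g k"
proof -
  have "poly_zmod (monom c k) = (\<Sum>i=1..k. coeff (monom c k) i \<odot> g i)"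
    by (rule poly_zmod_superset[OF degree_monom_le])
  also have "\<dots> = (\<Sum>i=1..k. if i = k then c \<odot> g k else 0)"
    by (intro sum.cong) auto
  finally show ?thesis using assms by simp
qed

text \<open>Since g_k and g_l multiply to g_(k+l), the span of the g_k is a copy of the polynomials
  without constant term. The hypotheses are there because \<open>poly_zmod\<close> forgets constant
  coefficients.\<close>

lemma circ_poly_zmod:
  assumes P: "coeff P 0 = 0" and Q: "coeff Q 0 = 0"
  shows "circ (poly_zmod P) (poly_zmod Q) = poly_zmod (P * Q)"
proof -
  have split: "R = (\<Sum>i=1..degree R. monom (coeff R i) i)"
    if "coeff R 0 = 0" for R :: "'a laurent poly"
  proof -
    have "R = (\<Sum>i\<le>degree R. monom (coeff R i) i)"
      by (rule poly_as_sum_of_monoms[symmetric])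
    also have "\<dots> = (\<Sum>i=1..degree R. monom (coeff R i) i)"
      using that by (intro sum.mono_neutral_right) (auto simp: not_le less_Suc_eq)
    finally show ?thesis .
  qed
  have "P * Q = (\<Sum>i=1..degree P. \<Sum>j=1..degree Q. monom (coeff P i * coeff Q j) (i + j))"
    by (subst split[OF P], subst split[OF Q]) (simp add: sum_product mult_monom)
  then have "poly_zmod (P * Q)
      = (\<Sum>i=1..degree P. \<Sum>j=1..degree Q. (coeff P i * coeff Q j) \<odot> g (i + j))"
    by (simp add: poly_zmod_sum poly_zmod_monom)
  also have "\<dots> = circ (poly_zmod P) (poly_zmod Q)"
    by (subst sum.swap) (simp add: poly_zmod_def circ_sum_left circ_sum_right circ_smul_left
        circ_smul_right circ_g_g smul_sum smul_smul mult.commute)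
  finally show ?thesis ..
qed

lemma circ_pow_poly_zmod:
  assumes "coeff P 0 = 0" "n \<ge> 1"
  shows "circ_pow (poly_zmod P) n = poly_zmod (P ^ n)"
  using assms(2)
proof (induction n rule: nat_induct_at_least)
  case base
  show ?case using circ_pow_1 by simp
next
  case (Suc n)
  then have "coeff (P ^ n) 0 = 0"
    using assms(1) by (simp add: coeff_0_power)
  with Suc assms(1) show ?case
    by (simp add: circ_pow_Suc circ_poly_zmod mult.commute)
qed

lemma e_eq_poly_zmod: "N \<ge> 2 \<Longrightarrow> e N = poly_zmod (monom hbar (N - 1) + monom 1 N)"
  by (simp add: e_def poly_zmod_add poly_zmod_monom)

text \<open>Under \<open>poly_zmod\<close> this is the binomial expansion of (x^N + hbar x^(N-1))^m
  with m = L n. Choosing the second summand i times gives hbar^i x^(d-i), and the scaling by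
  hbar^(-d) turns the power of hbar into -(d-i).\<close>

lemma circ_pow_scaled_e:
  fixes N L n :: nat
  assumes N: "N \<ge> 2" and L: "L \<ge> 1" and n: "n \<ge> 1"
  defines "d \<equiv> N * L * n"
  shows "circ_pow (hbar_pow (- int (N * L)) \<odot> circ_pow (e N) L) n
    = (\<Sum>j=1..d. (of_nat (d div N choose (d - j)) * hbar_pow (- int j)) \<odot>
        (g j :: 'k::field_char_0 zmodule))"
proof -
  define Q :: "'k laurent poly" where "Q = monom hbar (N - 1) + monom 1 N"
  define c :: "'k laurent" where "c = hbar_pow (- int (N * L))"
  define m where "m = L * n"
  have Q0: "coeff Q 0 = 0" using N by (simp add: Q_def)
  have m: "m \<ge> 1" using L n by (simp add: m_def)
  have d: "d = N * m" by (simp add: d_def m_def)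
  have md: "m < d" using N m by (simp add: d)
  have divN: "d div N = m" using N by (simp add: d)
  have "circ_pow (c \<odot> circ_pow (e N) L) n = circ_pow (poly_zmod (smult c (Q ^ L))) n"
    using N L Q0 by (simp add: e_eq_poly_zmod circ_pow_poly_zmod poly_zmod_smult
        del: One_nat_def flip: Q_def)
  also have "\<dots> = c ^ n \<odot> poly_zmod (Q ^ m)"
    using L n Q0 by (subst circ_pow_poly_zmod)
      (simp_all add: coeff_0_power smult_power m_def power_mult poly_zmod_smult)
  also have "Q ^ m = (\<Sum>i\<le>m. monom (of_nat (m choose i) * hbar_pow (int i)) (d - i))"
  proof -
    have "monom hbar (N - 1) ^ i * monom 1 N ^ (m - i) = monom (hbar_pow (int i) :: 'k laurent) (d - i)"
      if le: "i \<le> m" for i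
    proof -
      have "(N - 1) * i + N * (m - i) = d - i"
      proof -
        obtain k where k: "m = i + k" using le_Suc_ex[OF le] by blast
        obtain N' where N': "N = Suc N'" using N by (cases N) auto
        have "d = (N' * i + N * k) + i" by (simp add: d k N' distrib_left)
        then show ?thesis by (simp add: N' k)
      qed
      then show ?thesis
        by (simp add: monom_power mult_monom hbar_pow_power)
    qed
    then show ?thesis
      by (simp add: Q_def binomial_ring mult.assoc of_nat_poly smult_monom)
  qed
  also have "c ^ n \<odot> poly_zmod \<dots>
      = (\<Sum>i\<le>m. (of_nat (m choose i) * hbar_pow (- int (d - i))) \<odot> g (d - i))"
  proof -
    have coef: "c ^ n * (of_nat (m choose i) * hbar_pow (int i))
        = of_nat (m choose i) * hbar_pow (- int (d - i))" and pos: "d - i \<ge> 1" if "i \<le> m" for i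
    proof -
      from that md show "d - i \<ge> 1" by simp
      have "int n * (- int (N * L)) + int i = - int (d - i)"
        using that md by (simp add: d_def of_nat_diff)
      then have "c ^ n * hbar_pow (int i) = hbar_pow (- int (d - i))"
        by (simp only: c_def hbar_pow_power hbar_pow_mult)
      then show "c ^ n * (of_nat (m choose i) * hbar_pow (int i))
        = of_nat (m choose i) * hbar_pow (- int (d - i))"
        by (simp add: mult.left_commute)
    qed
    show ?thesis
      by (simp add: poly_zmod_sum poly_zmod_monom smul_sum smul_smul coef pos del: One_nat_def)
  qed
  \<comment> \<open>The added binomial coefficients vanish. With the longer range, j = d - i runs
    through exactly 1, ..., d.\<close>
  also have "\<dots> = (\<Sum>i<d. (of_nat (m choose i) * hbar_pow (- int (d - i))) \<odot> g (d - i))"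
  proof (rule sum.mono_neutral_left)
    show "{..m} \<subseteq> {..<d}"
      using md by auto
    show "\<forall>i\<in>{..<d} - {..m}. (of_nat (m choose i) * hbar_pow (- int (d - i))) \<odot>
        (g (d - i) :: 'k zmodule) = 0"
      by (simp add: binomial_eq_0)
  qed simp
  also have "\<dots> = (\<Sum>j=1..d. (of_nat (m choose (d - j)) * hbar_pow (- int j)) \<odot> g j)"
    by (rule sum.reindex_bij_witness[of _ "\<lambda>j. d - j" "\<lambda>i. d - i"]) auto
  finally show ?thesis by (simp add: c_def divN)
qed

section \<open>The harmonic exponential\<close>

definition emb_fps :: "(nat \<Rightarrow> 'k::field_char_0 zmodule) \<Rightarrow> 'k free_alg fps" where
  "emb_fps h = Abs_fps (\<lambda>n. emb (h n))"

definition smul_fps :: "'k::field_char_0 laurent \<Rightarrow> 'k free_alg fps \<Rightarrow> 'k free_alg fps" where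
  "smul_fps c P = Abs_fps (\<lambda>n. c \<odot> P $ n)"

text \<open>The operator X d/dX. It preserves degrees, so the recurrences below need no index
  shift.\<close>

definition euler_fps :: "'k::field_char_0 free_alg fps \<Rightarrow> 'k free_alg fps" where
  "euler_fps P = Abs_fps (\<lambda>n. of_nat n \<odot> P $ n)"

lemma emb_fps_nth [simp]: "emb_fps h $ n = emb (h n)"
  by (simp add: emb_fps_def)

lemma smul_fps_nth [simp]: "smul_fps c P $ n = c \<odot> P $ n"
  by (simp add: smul_fps_def)

lemma euler_fps_nth [simp]: "euler_fps P $ n = of_nat n \<odot> P $ n"
  by (simp add: euler_fps_def)

lemma harm_fps_nth: "harm_fps P f $ n = (\<Sum>i=0..n. harm (P $ i) (f $ (n - i)))"
  by (simp add: harm_fps_def)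

lemma euler_fps_emb_fps: "euler_fps (emb_fps h) = emb_fps (\<lambda>n. of_nat n \<odot> h n)"
  by (simp add: fps_eq_iff emb_smul)

lemma harm_fps_smul_left: "harm_fps (smul_fps c P) f = smul_fps c (harm_fps P f)"
  by (simp add: fps_eq_iff harm_fps_nth harm_smul_left smul_sum)

lemma harm_fps_zero_left [simp]: "harm_fps 0 f = 0"
  by (simp add: fps_eq_iff harm_fps_nth)

lemma euler_harm_fps:
  "euler_fps (harm_fps P f) = harm_fps (euler_fps P) f + harm_fps P (euler_fps f)"
proof (rule fps_ext)
  fix n
  have "of_nat n \<odot> harm (P $ i) (f $ (n - i))
      = of_nat i \<odot> harm (P $ i) (f $ (n - i)) + of_nat (n - i) \<odot> harm (P $ i) (f $ (n - i))"
    if "i \<le> n" for i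
    using that by (simp flip: smul_add_left of_nat_add)
  then show "euler_fps (harm_fps P f) $ n
      = (harm_fps (euler_fps P) f + harm_fps P (euler_fps f)) $ n"
    by (simp add: harm_fps_nth harm_smul_left harm_smul_right smul_sum sum.distrib)
qed

lemma harm_fps_emb_right_commute:
  "harm_fps (harm_fps P (emb_fps h)) (emb_fps h') = harm_fps (harm_fps P (emb_fps h')) (emb_fps h)"
proof (rule fps_ext)
  fix n
  \<comment> \<open>The index of P is made the outer one; reversing the inner sum then exchanges the
    roles of the two series, and \<open>harm_emb_right_commute\<close> applies termwise.\<close>
  have expand: "harm_fps (harm_fps P (emb_fps a)) (emb_fps b) $ n
      = (\<Sum>j=0..n. \<Sum>i=0..n-j. harm (harm (P $ j) (emb (a i))) (emb (b (n - j - i))))"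
    for a b :: "nat \<Rightarrow> 'a zmodule"
    by (simp add: harm_fps_nth harm_sum_left
      fps_mult_assoc_lemma[of "\<lambda>i j k. harm (harm (P $ i) (emb (a j))) (emb (b k))" n])
  have eq: "(\<Sum>i=0..m. harm (harm (P $ j) (emb (h i))) (emb (h' (m - i))))
      = (\<Sum>i=0..m. harm (harm (P $ j) (emb (h' i))) (emb (h (m - i))))" for j m
    by (subst sum.atLeastAtMost_rev) (simp add: harm_emb_right_commute)
  then show "harm_fps (harm_fps P (emb_fps h)) (emb_fps h') $ n
      = harm_fps (harm_fps P (emb_fps h')) (emb_fps h) $ n"
    by (simp only: expand eq)
qed

text \<open>The power rule. In the induction step the Leibniz rule leaves Df multiplied in before
  the last factor f, and \<open>harm_fps_emb_right_commute\<close> moves it to the end.\<close>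

lemma euler_harm_power:
  fixes h :: "nat \<Rightarrow> 'k::field_char_0 zmodule"
  defines "f \<equiv> emb_fps h"
  shows "euler_fps (harm_power f (Suc n))
    = smul_fps (of_nat (Suc n)) (harm_fps (harm_power f n) (euler_fps f))"
proof (induction n)
  case 0
  have "euler_fps 1 = (0 :: 'k free_alg fps)"
    by (simp add: fps_eq_iff)
  then show ?case
    by (simp add: euler_harm_fps) (simp add: fps_eq_iff)
next
  case (Suc n)
  have "euler_fps (harm_power f (Suc (Suc n)))
      = smul_fps (of_nat (Suc n)) (harm_fps (harm_fps (harm_power f n) (euler_fps f)) f)
        + harm_fps (harm_power f (Suc n)) (euler_fps f)"
    by (simp only: harm_power.simps(2)[of f "Suc n"] euler_harm_fps Suc harm_fps_smul_left)
  also have "harm_fps (harm_fps (harm_power f n) (euler_fps f)) f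
      = harm_fps (harm_power f (Suc n)) (euler_fps f)"
    by (simp add: f_def euler_fps_emb_fps harm_fps_emb_right_commute)
  finally show ?case
    unfolding of_nat_Suc[of "Suc n"]
    by (simp add: fps_eq_iff smul_add_left add.commute del: harm_power.simps of_nat_Suc)
qed

lemma harm_power_nth_eq_0:
  assumes "f $ 0 = 0" "n < k"
  shows "harm_power f k $ n = 0"
  using assms(2)
proof (induction k arbitrary: n)
  case (Suc k)
  have "harm (harm_power f k $ i) (f $ (n - i)) = 0" if "i \<le> n" for i
    using that Suc assms(1) by (cases "i = n") simp_all
  then show ?case by (simp add: harm_fps_nth)
qed simp

text \<open>The k-th power has order at least k. The free bound m lets coefficients of different
  degrees share one range of summation.\<close>

lemma harm_exp_nth:
  assumes "f $ 0 = 0" "n \<le> m"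
  shows "harm_exp f $ n = (\<Sum>k\<le>m. const (1 / fact k) \<odot> harm_power f k $ n)"
proof -
  have "(\<Sum>\<^sub>\<infinity>k\<in>{1..}. fps_const (const (1 / fact k) \<odot> 1) * harm_power f k) $ n
      = (\<Sum>k | k \<in> {1..} \<and> k \<le> n. const (1 / fact k) \<odot> harm_power f k $ n)"
    by (subst fps_nth_infsum) (simp_all add: smul_mult_left harm_power_nth_eq_0[OF assms(1)])
  also have "{k. k \<in> {1..} \<and> k \<le> n} = {..n} - {0}" by auto
  finally have "harm_exp f $ n = (\<Sum>k\<le>n. const (1 / fact k) \<odot> harm_power f k $ n)"
    by (simp add: harm_exp_def sum.remove[of "{..n}" 0])
  also have "\<dots> = (\<Sum>k\<le>m. const (1 / fact k) \<odot> harm_power f k $ n)"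
    using assms by (intro sum.mono_neutral_left) (auto simp: harm_power_nth_eq_0)
  finally show ?thesis .
qed

text \<open>This is DE = E * Df with D = X d/dX, read off at degree n. The summand i = n is absent
  because Df has no constant term.\<close>

lemma harm_exp_recurrence:
  fixes h :: "nat \<Rightarrow> 'k::field_char_0 zmodule"
  assumes h0: "h 0 = 0"
  defines "E \<equiv> harm_exp (emb_fps h)"
  shows "of_nat n \<odot> E $ n = (\<Sum>i<n. harm (E $ i) (emb (of_nat (n - i) \<odot> h (n - i))))"
proof -
  define P where "P = harm_power (emb_fps h)"
  have f0: "emb_fps h $ 0 = 0" by (simp add: h0)
  have P0: "of_nat n \<odot> P 0 $ n = 0"
    by (cases n) (simp_all add: P_def)
  have PSuc: "const (1 / fact (Suc k)) \<odot> of_nat n \<odot> P (Suc k) $ n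
      = const (1 / fact k) \<odot> (\<Sum>i<n. harm (P k $ i) (emb (of_nat (n - i) \<odot> h (n - i))))" for k
  proof -
    have "of_nat n \<odot> P (Suc k) $ n = euler_fps (P (Suc k)) $ n"
      by simp
    also have "\<dots> = of_nat (Suc k) \<odot>
        (\<Sum>i=0..n. harm (P k $ i) (emb (of_nat (n - i) \<odot> h (n - i))))"
      unfolding P_def euler_harm_power
      by (simp add: harm_fps_nth emb_smul del: of_nat_Suc)
    also have "(\<Sum>i=0..n. harm (P k $ i) (emb (of_nat (n - i) \<odot> h (n - i))))
        = (\<Sum>i<n. harm (P k $ i) (emb (of_nat (n - i) \<odot> h (n - i))))"
      by (intro sum.mono_neutral_right) auto
    finally have "const (1 / fact (Suc k)) \<odot> of_nat n \<odot> P (Suc k) $ n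
      = (const (1 / fact (Suc k)) * const (of_nat (Suc k)))
        \<odot> (\<Sum>i<n. harm (P k $ i) (emb (of_nat (n - i) \<odot> h (n - i))))"
      by (simp only: smul_smul const_of_nat)
    also have "const (1 / fact (Suc k)) * const (of_nat (Suc k)) = (const (1 / fact k) :: 'k laurent)"
      by (simp add: const_mult del: of_nat_Suc)
    finally show ?thesis .
  qed
  have "of_nat n \<odot> E $ n = (\<Sum>k\<le>n. const (1 / fact k) \<odot> of_nat n \<odot> P k $ n)"
    unfolding E_def P_def harm_exp_nth[OF f0 order_refl] by (simp add: smul_sum smul_smul mult.commute)
  also have "\<dots> = (\<Sum>k<n. const (1 / fact (Suc k)) \<odot> of_nat n \<odot> P (Suc k) $ n)"
    by (simp add: sum.atMost_shift P0)
  also have "\<dots> = (\<Sum>k<n. \<Sum>i<n. harm (const (1 / fact k) \<odot> P k $ i)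
      (emb (of_nat (n - i) \<odot> h (n - i))))"
    unfolding PSuc by (simp add: smul_sum harm_smul_left)
  also have "\<dots> = (\<Sum>i<n. harm (\<Sum>k<n. const (1 / fact k) \<odot> P k $ i)
      (emb (of_nat (n - i) \<odot> h (n - i))))"
    by (subst sum.swap) (simp add: harm_sum_left)
  also have "\<dots> = (\<Sum>i<n. harm (E $ i) (emb (of_nat (n - i) \<odot> h (n - i))))"
  proof (intro sum.cong refl)
    fix i assume "i \<in> {..<n}"
    \<comment> \<open>The n summands k < n already give the full coefficient of E at i, since i <
      n.\<close>
    then have "i \<le> n - 1" "{..<n} = {..n - 1}" by auto
    then show "harm (\<Sum>k<n. const (1 / fact k) \<odot> P k $ i) (emb (of_nat (n - i) \<odot> h (n - i)))
      = harm (E $ i) (emb (of_nat (n - i) \<odot> h (n - i)))"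
      by (simp add: E_def P_def harm_exp_nth[OF f0, of i "n - 1"])
  qed
  finally show ?thesis .
qed

lemma smul_of_nat_cancel:
  fixes x y :: "'a \<Rightarrow>\<^sub>0 'k::field_char_0 laurent"
  assumes "n > 0" "of_nat n \<odot> x = of_nat n \<odot> y"
  shows "x = y"
proof -
  have "const (1 / of_nat n) \<odot> of_nat n \<odot> z = z" for z :: "'a \<Rightarrow>\<^sub>0 'k laurent"
    using assms(1) by (simp add: smul_smul const_mult flip: const_of_nat)
  then show ?thesis using assms(2) by metis
qed

text \<open>The recurrence expresses n times the coefficient at n through earlier ones, and n is
  invertible in the coefficient field.\<close>

lemma harm_exp_unique:
  fixes h :: "nat \<Rightarrow> 'k::field_char_0 zmodule"
  assumes h0: "h 0 = 0" and F0: "F $ 0 = 1"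
    and rec: "\<And>n. n > 0 \<Longrightarrow>
      of_nat n \<odot> F $ n = (\<Sum>i<n. harm (F $ i) (emb (of_nat (n - i) \<odot> h (n - i))))"
  shows "F = harm_exp (emb_fps h)"
proof (rule fps_ext)
  fix n show "F $ n = harm_exp (emb_fps h) $ n"
  proof (induction n rule: less_induct)
    case (less n)
    show ?case
    proof (cases "n = 0")
      case True
      then show ?thesis
        by (simp add: F0 harm_exp_nth[of _ 0 0] h0)
    next
      case False
      have "of_nat n \<odot> F $ n = of_nat n \<odot> harm_exp (emb_fps h) $ n"
      proof -
        have "of_nat n \<odot> F $ n = (\<Sum>i<n. harm (F $ i) (emb (of_nat (n - i) \<odot> h (n - i))))"
          using False by (intro rec) simp
        also have "\<dots> = (\<Sum>i<n. harm (harm_exp (emb_fps h) $ i) (emb (of_nat (n - i) \<odot> h (n - i))))"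
          by (intro sum.cong refl) (simp only: lessThan_iff less)
        also have "\<dots> = of_nat n \<odot> harm_exp (emb_fps h) $ n"
          by (rule harm_exp_recurrence[where h = h, OF h0, symmetric])
        finally show ?thesis .
      qed
      then show ?thesis
        by (rule smul_of_nat_cancel[rotated]) (use False in simp)
    qed
  qed
qed

text \<open>The factor y is either inserted into one of the m + 1 gaps of the product v ... v or
  merged with one of its m factors.\<close>

lemma emb_power_harm:
  "harm (emb v ^ m) (emb y) = (\<Sum>j\<le>m. emb v ^ j * emb y * emb v ^ (m - j))
    + (\<Sum>j<m. emb v ^ j * emb (circ v y) * emb v ^ (m - 1 - j))"
proof (induction m)
  case 0
  show ?case by (simp add: harm_one_left)
next
  case (Suc m)
  have "harm (emb v ^ Suc m) (emb y)
      = harm (emb v ^ m) (emb y) * emb v + emb v ^ Suc m * emb y + emb v ^ m * emb (circ v y)"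
    by (simp only: power_Suc2 harm_snoc_emb)
  also have "harm (emb v ^ m) (emb y) * emb v = (\<Sum>j\<le>m. emb v ^ j * emb y * emb v ^ (Suc m - j))
      + (\<Sum>j<m. emb v ^ j * emb (circ v y) * emb v ^ (m - j))"
    unfolding Suc distrib_right sum_distrib_right
    by (intro arg_cong2[where f = "(+)"] sum.cong refl)
      (simp_all add: mult.assoc Suc_diff_le Suc_diff_Suc flip: power_Suc2)
  finally show ?case
    by (simp add: add_ac)
qed

lemma harm_uminus: "harm (- x) y = - harm x y" "harm x (- y) = - harm x y"
  using harm_add_left[of x "- x" y] harm_add_right[of x y "- y"]
  by (simp_all add: eq_neg_iff_add_eq_0 add.commute)

text \<open>The sums from \<open>emb_power_harm\<close> telescope with alternating signs.\<close>

lemma emb_power_recurrence: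
  "(\<Sum>i<n. harm ((- emb v) ^ i) (- emb (circ_pow v (n - i)))) = of_nat n * (- emb v) ^ n"
proof -
  define u where "u = emb v"
  define S where "S r = (\<Sum>j\<le>n - r. u ^ j * emb (circ_pow v r) * u ^ (n - r - j))" for r
  \<comment> \<open>The value 0 beyond n accounts for i = 0, where there is no factor to merge
    with.\<close>
  define T where "T r = (if r \<le> n then (- 1) ^ (n - r) * S r else 0)" for r
  have "harm ((- u) ^ i) (- emb (circ_pow v (n - i))) = T (n - i + 1) - T (n - i)"
    if "i < n" for i
  proof -
    define r where "r = n - i"
    have r: "i = n - r" "r \<ge> 1" "r \<le> n" using that by (auto simp: r_def)
    have step: "circ v (circ_pow v r) = circ_pow v (Suc r)"
      using r by (simp add: circ_pow_Suc circ_commute)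
    \<comment> \<open>Insertions keep the exponent r of the distinguished factor and merges raise it
      to r + 1. With the alternating sign each summand becomes a difference of consecutive values of
      T.\<close>
    have "harm (u ^ i) (emb (circ_pow v r)) = S r + (if i = 0 then 0 else S (Suc r))"
    proof -
      have "{..<i} = {..n - Suc r}" "i - 1 = n - Suc r" if "i \<noteq> 0"
        using r that by auto
      then show ?thesis
        unfolding u_def emb_power_harm step by (auto simp: S_def u_def r(1))
    qed
    moreover have "harm ((- u) ^ i) (- y) = - ((- 1) ^ i * harm (u ^ i) y)" for y
      by (cases "even i") (simp_all add: harm_uminus)
    moreover have "T r = (- 1) ^ i * S r"
      using r by (simp add: T_def)
    moreover have "T (Suc r) = (if i = 0 then 0 else - ((- 1) ^ i * S (Suc r)))"
    proof (cases "i = 0")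
      case False
      then have "i = Suc (n - Suc r)" "Suc r \<le> n" using r by simp_all
      then show ?thesis using r by (simp add: T_def)
    qed (use r in \<open>simp add: T_def\<close>)
    ultimately show ?thesis
      by (simp add: distrib_left flip: r_def)
  qed
  then have "(\<Sum>i<n. harm ((- u) ^ i) (- emb (circ_pow v (n - i))))
      = (\<Sum>i<n. T (n - i + 1) - T (n - i))" by simp
  also have "\<dots> = (\<Sum>r=1..n. T (Suc r) - T r)"
    by (rule sum.reindex_bij_witness[of _ "\<lambda>r. n - r" "\<lambda>i. n - i"]) auto
  also have "\<dots> = of_nat n * (- u) ^ n"
  proof (cases n)
    case (Suc m)
    have "(\<Sum>r=1..n. T (Suc r) - T r) = T (Suc n) - T 1"
      by (rule sum_Suc_diff) (simp add: Suc)
    also have "\<dots> = - ((- 1) ^ m * S 1)"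
      by (simp add: T_def Suc)
    \<comment> \<open>For r = 1 the distinguished factor is v itself, so all n positions give the
      same product.\<close>
    also have "S 1 = of_nat n * u ^ n"
    proof -
      have "S 1 = (\<Sum>j\<le>m. u ^ Suc m)"
      proof (unfold S_def, rule sum.cong)
        fix j assume "j \<in> {..m}"
        then have j: "Suc j + (n - 1 - j) = Suc m" using Suc by simp
        show "u ^ j * emb (circ_pow v 1) * u ^ (n - 1 - j) = u ^ Suc m"
          unfolding circ_pow_1 u_def[symmetric] power_Suc2[symmetric] power_add[symmetric] j ..
      qed (simp add: Suc)
      then show ?thesis by (simp add: Suc)
    qed
    finally show ?thesis
      by (cases "even m") (simp_all add: Suc)
  qed simp
  finally show ?thesis by (simp add: u_def)
qed

section \<open>The geometric series as a harmonic exponential\<close>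

lemma geom_inverse_X_power_nth:
  assumes "M > 0"
  shows "geom_inverse (fps_const a * fps_X ^ M) $ n = (if M dvd n then (- a) ^ (n div M) else 0)"
proof -
  have power: "(- (fps_const a * fps_X ^ M)) ^ k = fps_const ((- a) ^ k) * fps_X ^ (M * k)" for k
  proof (induction k)
    case (Suc k)
    have "(- (fps_const a * fps_X ^ M)) ^ Suc k
        = - (fps_const ((- a) ^ k) * (fps_X ^ (M * k) * fps_const a) * fps_X ^ M)"
      by (simp only: power_Suc2 Suc mult.assoc mult_minus_right)
    \<comment> \<open>X is central although the coefficients do not commute with one
      another.\<close>
    also have "fps_X ^ (M * k) * fps_const a = fps_const a * fps_X ^ (M * k)"
      by (simp add: fps_eq_iff fps_X_power_mult_nth fps_X_power_mult_right_nth)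
    also have "- (fps_const ((- a) ^ k) * (fps_const a * fps_X ^ (M * k)) * fps_X ^ M)
        = fps_const (- ((- a) ^ k * a)) * (fps_X ^ (M * k) * fps_X ^ M)"
      by (simp add: mult.assoc flip: fps_const_mult fps_const_neg)
    finally show ?case
      by (simp only: power_Suc2 mult_minus_right mult_Suc_right power_add[symmetric] add.commute)
  qed simp
  have nth: "(fps_const ((- a) ^ k) * fps_X ^ (M * k)) $ m = (if m = M * k then (- a) ^ k else 0)"
    for k m
    by (simp add: fps_X_power_mult_right_nth)
  have "geom_inverse (fps_const a * fps_X ^ M) $ n
      = (\<Sum>k | k \<in> UNIV \<and> k \<le> n. (fps_const ((- a) ^ k) * fps_X ^ (M * k)) $ n)"
    unfolding geom_inverse_def power
  proof (rule fps_nth_infsum)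
    fix k m :: nat assume "m < k"
    then have "m \<noteq> M * k"
      using assms by (cases M) auto
    then show "(fps_const ((- a) ^ k) * fps_X ^ (M * k)) $ m = 0"
      unfolding nth by simp
  qed
  also have "\<dots> = (\<Sum>k\<le>n. if n = M * k then (- a) ^ k else 0)"
    unfolding nth by (simp add: atMost_def)
  also have "\<dots> = (if M dvd n then (- a) ^ (n div M) else 0)"
  proof (cases "M dvd n")
    case True
    then obtain q where n: "n = M * q" by blast
    have "q \<le> n" using assms by (simp add: n)
    moreover have "(\<Sum>k\<le>n. if n = M * k then (- a) ^ k else 0)
        = (\<Sum>k\<le>n. if k = q then (- a) ^ q else 0)"
      using assms by (intro sum.cong) (auto simp: n)
    ultimately show ?thesis
      using assms by (simp add: n)
  qed (auto intro!: sum.neutral)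
  finally show ?thesis .
qed

lemma of_nat_mult_conv_smul: "of_nat n * x = of_nat n \<odot> (x :: 'k::field_char_0 free_alg)"
  by (induction n) (simp_all add: distrib_right smul_add_left)

text \<open>\<open>emb_power_recurrence\<close> has the shape of Newton's identities, with
  concatenation powers of v as elementary symmetric functions and circle powers as power sums. Hence
  this is the analogue of the identity between the sum of e_n (-X)^n and exp of minus the sum of p_n
  X^n / n.\<close>

lemma geom_inverse_conv_harm_exp:
  fixes v :: "'k::field_char_0 zmodule"
  assumes M: "M > 0"
  shows "geom_inverse (fps_const (emb v) * fps_X ^ M) = harm_exp (emb_fps (\<lambda>n.
    if n > 0 \<and> M dvd n then - (const (of_nat M / of_nat n) \<odot> circ_pow v (n div M)) else 0))"
    (is "?F = harm_exp (emb_fps ?h)")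
proof (rule harm_exp_unique)
  show "?h 0 = 0" by simp
  show "?F $ 0 = 1"
    by (simp add: geom_inverse_X_power_nth[OF M])
next
  fix n :: nat assume "n > 0"
  let ?t = "\<lambda>i. harm (?F $ i) (emb (of_nat (n - i) \<odot> ?h (n - i)))"
  show "of_nat n \<odot> ?F $ n = (\<Sum>i<n. ?t i)"
  proof (cases "M dvd n")
    case False
    \<comment> \<open>A nonzero summand would need M to divide both i and n - i, hence n.\<close>
    have "?t i = 0" if "i < n" for i
    proof (cases "M dvd i")
      case True
      then have "\<not> M dvd n - i"
        using False that by (metis dvd_diffD less_imp_le)
      then show ?thesis by simp
    qed (simp add: geom_inverse_X_power_nth[OF M])
    then show ?thesis
      using False by (simp add: geom_inverse_X_power_nth[OF M])
  next
    case True
    then obtain q where n: "n = M * q" by blast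
    have "(\<Sum>i<n. ?t i) = (\<Sum>i\<in>(\<lambda>r. M * r) ` {..<q}. ?t i)"
    proof (rule sum.mono_neutral_right)
      show "(\<lambda>r. M * r) ` {..<q} \<subseteq> {..<n}"
        using M by (auto simp: n)
      show "\<forall>i\<in>{..<n} - (\<lambda>r. M * r) ` {..<q}. ?t i = 0"
      proof
        fix i assume i: "i \<in> {..<n} - (\<lambda>r. M * r) ` {..<q}"
        have "\<not> M dvd i"
        proof
          assume "M dvd i"
          then obtain r where "i = M * r" by blast
          with i show False using M by (auto simp: n)
        qed
        then show "?t i = 0" by (simp add: geom_inverse_X_power_nth[OF M])
      qed
    qed simp
    also have "\<dots> = (\<Sum>r<q. ?t (M * r))"
      using M by (subst sum.reindex) (auto simp: inj_on_def)
    also have "\<dots> = (\<Sum>r<q. of_nat M \<odot> harm ((- emb v) ^ r) (- emb (circ_pow v (q - r))))"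
    proof (intro sum.cong refl)
      fix r assume "r \<in> {..<q}"
      then have r: "r < q" by simp
      have diff: "n - M * r = M * (q - r)"
        by (simp add: n diff_mult_distrib2)
      \<comment> \<open>The weight n - i cancels the denominator in the exponent. What remains is
        the same factor M for every r.\<close>
      have "of_nat (M * (q - r)) * const (of_nat M / of_nat (M * (q - r))) = (of_nat M :: 'k laurent)"
        using M r by (simp only: const_mult flip: const_of_nat) simp
      then have "of_nat (M * (q - r)) \<odot> ?h (M * (q - r)) = - (of_nat M \<odot> circ_pow v (q - r))"
        using M r by (simp add: smul_uminus_right smul_smul del: of_nat_mult)
      then show "?t (M * r) = of_nat M \<odot> harm ((- emb v) ^ r) (- emb (circ_pow v (q - r)))"
        unfolding diff using M
        by (simp add: geom_inverse_X_power_nth emb_uminus emb_smul harm_smul_right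
            harm_uminus smul_uminus_right)
    qed
    also have "\<dots> = of_nat M \<odot> of_nat q \<odot> (- emb v) ^ q"
      by (simp only: emb_power_recurrence of_nat_mult_conv_smul flip: smul_sum)
    finally show ?thesis
      using M by (simp add: n geom_inverse_X_power_nth smul_smul)
  qed
qed

section \<open>Comparison of the exponents\<close>

lemma scalar_fps_const_mult_nth:
  "(fps_const (emb x) * scalar_fps s) $ n = emb (const (s $ n) \<odot> x)"
  by (simp add: scalar_fps_def smul_mult_right emb_smul)

lemma phi_superset:
  assumes "k \<le> n"
  shows "phi k = (\<Sum>j=1..n. (of_nat (fact (j - 1) * Stirling k j) * hbar_pow (int k - int j)) \<odot> g j)"
  unfolding phi_def using assms by (intro sum.mono_neutral_left) auto

text \<open>Extending every \<open>phi k\<close> to the range j \<le> n allows the sums to be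
  interchanged. The powers of hbar combine to -k + (k - j) = -j, independent of k.\<close>

lemma sum_phi:
  fixes c :: "nat \<Rightarrow> 'k::field_char_0"
  shows "(\<Sum>k=2..n. const (c k) \<odot> (const (1 / fact k) * hbar_pow (- int k)) \<odot> phi k)
    = (\<Sum>j=1..n. (const (\<Sum>k=2..n. of_nat (fact (j - 1) * Stirling k j) / fact k * c k)
        * hbar_pow (- int j)) \<odot> g j)"
proof -
  have coef: "const (c k) * (const (1 / fact k) * hbar_pow (- int k) *
        (of_nat (fact (j - 1) * Stirling k j) * hbar_pow (int k - int j)))
      = const (of_nat (fact (j - 1) * Stirling k j) / fact k * c k) * hbar_pow (- int j)" for k j
  proof -
    have "const (c k) * (const (1 / fact k) * hbar_pow (- int k) *
        (of_nat (fact (j - 1) * Stirling k j) * hbar_pow (int k - int j)))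
      = (const (c k) * const (1 / fact k) * const (of_nat (fact (j - 1) * Stirling k j)))
        * (hbar_pow (- int k) * hbar_pow (int k - int j))"
      by (simp only: const_of_nat mult_ac)
    then show ?thesis
      by (simp add: const_mult hbar_pow_mult mult_ac)
  qed
  have "(\<Sum>k=2..n. const (c k) \<odot> (const (1 / fact k) * hbar_pow (- int k)) \<odot> phi k)
      = (\<Sum>k=2..n. \<Sum>j=1..n.
          (const (of_nat (fact (j - 1) * Stirling k j) / fact k * c k) * hbar_pow (- int j)) \<odot> g j)"
  proof (intro sum.cong refl)
    fix k assume "k \<in> {2..n}"
    then have "k \<le> n" by simp
    show "const (c k) \<odot> (const (1 / fact k) * hbar_pow (- int k)) \<odot> phi k = (\<Sum>j=1..n.
      (const (of_nat (fact (j - 1) * Stirling k j) / fact k * c k) * hbar_pow (- int j)) \<odot> g j)"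
      by (simp only: phi_superset[OF \<open>k \<le> n\<close>] smul_sum smul_smul coef)
  qed
  then show ?thesis
    by (subst (asm) sum.swap) (simp only: const_sum sum_distrib_right sum_smul)
qed

theorem theorem4p2:
  fixes N L :: nat
  assumes "N \<ge> 2" and "L \<ge> 1"
  shows "geom_inverse
      (fps_const (emb (hbar_pow (- int (N * L)) \<odot> circ_pow (e N) L)) * fps_X ^ (N * L))
    = harm_exp (- (\<Sum>\<^sub>\<infinity>k\<in>{2..}.
        fps_const (emb ((const (1 / fact k) * hbar_pow (- int k)) \<odot> phi k)) *
        scalar_fps (\<Sum>m=1..N*L.
          (varphi (1 / of_nat N) oo (fps_const (root_of_unity (N * L) ^ m) * fps_X)) ^ k)))"
proof -
  define M where "M = N * L"
  define v :: "complex zmodule" where "v = hbar_pow (- int M) \<odot> circ_pow (e N) L"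
  define s where "s k = (\<Sum>m=1..M. (varphi (1 / of_nat N) oo
    (fps_const (root_of_unity M ^ m) * fps_X)) ^ k)" for k
  define G where "G k = fps_const (emb ((const (1 / fact k) * hbar_pow (- int k)) \<odot> phi k))
    * scalar_fps (s k)" for k
  have M: "M > 0" using assms by (simp add: M_def)
  \<comment> \<open>\<open>varphi\<close> has no constant term, so its k-th power starts in degree
    k. This makes the infinite sum over k finite in each degree.\<close>
  have s_0: "s k $ d = 0" if "d < k" for k d
    unfolding s_def root_of_unity_filter[OF M]
    using startsby_zero_power_prefix[of "varphi (1 / of_nat N) :: complex fps" k] that
    by (simp add: varphi_def)
  have "(- (\<Sum>\<^sub>\<infinity>k\<in>{2..}. G k)) $ d = emb (if d > 0 \<and> M dvd d
      then - (const (of_nat M / of_nat d) \<odot> circ_pow v (d div M)) else 0)" for d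
  proof -
    have "(\<Sum>\<^sub>\<infinity>k\<in>{2..}. G k) $ d = (\<Sum>k | k \<in> {2..} \<and> k \<le> d. G k $ d)"
      by (rule fps_nth_infsum) (simp only: G_def scalar_fps_const_mult_nth s_0 const_0 smul_zero_left emb_0)
    also have "{k. k \<in> {2..} \<and> k \<le> d} = {2..d}" by auto
    also have "(\<Sum>k=2..d. G k $ d) = emb (\<Sum>k=2..d. const (s k $ d) \<odot>
        (const (1 / fact k) * hbar_pow (- int k)) \<odot> phi k)"
      by (simp only: G_def scalar_fps_const_mult_nth emb_sum)
    also have "\<dots> = emb (\<Sum>j=1..d. (const (if M dvd d
        then of_nat M / of_nat d * of_nat (d div N choose (d - j)) else 0) * hbar_pow (- int j)) \<odot> g j)"
      unfolding sum_phi
    proof (intro arg_cong[where f = emb] sum.cong refl)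
      fix j assume "j \<in> {1..d}"
      then have "1 \<le> j" "j \<le> d" by auto
      from Stirling_sum_varphi[OF assms this]
      show "(const (\<Sum>k=2..d. of_nat (fact (j - 1) * Stirling k j) / fact k * s k $ d)
          * hbar_pow (- int j)) \<odot> g j
        = (const (if M dvd d then of_nat M / of_nat d * of_nat (d div N choose (d - j)) else 0)
          * hbar_pow (- int j)) \<odot> (g j :: complex zmodule)"
        unfolding s_def M_def by (simp only:)
    qed
    \<comment> \<open>For positive multiples d = M n this is the expansion of the n-th circle power
      of v. For d = 0 the sum over j is empty, and otherwise all its coefficients vanish.\<close>
    also have "\<dots> = emb (if d > 0 \<and> M dvd d
      then const (of_nat M / of_nat d) \<odot> circ_pow v (d div M) else 0)"
    proof (cases "d > 0 \<and> M dvd d")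
      case True
      then obtain n where d: "d = N * L * n" by (auto simp: M_def)
      then have n: "n \<ge> 1" "d div M = n" using True M by (auto simp: M_def)
      have "(\<Sum>j=1..d. (const (of_nat M / of_nat d * of_nat (d div N choose (d - j)))
            * hbar_pow (- int j)) \<odot> g j)
          = const (of_nat M / of_nat d) \<odot>
            (\<Sum>j=1..d. (of_nat (d div N choose (d - j)) * hbar_pow (- int j)) \<odot> g j)"
        by (simp only: smul_sum smul_smul const_mult[symmetric] const_of_nat mult.assoc)
      also have "\<dots> = const (of_nat M / of_nat d) \<odot> circ_pow v (d div M)"
        unfolding v_def M_def
        by (simp only: circ_pow_scaled_e[OF assms n(1)] n(2)[unfolded M_def d] d)
      finally show ?thesis using True by (simp only: if_True simp_thms)
    qed auto
    finally show ?thesis by (simp add: emb_uminus)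
  qed
  then have "- (\<Sum>\<^sub>\<infinity>k\<in>{2..}. G k) = emb_fps (\<lambda>d. if d > 0 \<and> M dvd d
      then - (const (of_nat M / of_nat d) \<odot> circ_pow v (d div M)) else 0)"
    by (simp only: fps_eq_iff emb_fps_nth) simp
  with geom_inverse_conv_harm_exp[OF M, of v] show ?thesis
    by (simp only: G_def s_def v_def M_def)
qed

end
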